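(* Let $R$ be a principal ideal domain with fraction field $K$, $n\ge1$, $F(x,z)=\sum_{i=0}^nf_ix^{n-i}z^i\in R[x,z]$ of degree $n$ with $f_0\ne0$ and separable over $K$, and $r\in R^\times$. Let $(A,B)$ be a pair of symmetric $n\times n$ matrices over $R$ with $(-1)^{\lfloor n/2\rfloor}\det(xA+zB)=r\cdot\tfrac1{f_0}F(x,f_0z)$. Then the $G_n(R)$-orbit of $(A,B)$ lies in the image of $\mathsf{orb}_{F,r}$ if and only if $$p_i\big(\tfrac1{f_0}\cdot(-A^{-1}B)\big)\in\operatorname{Mat}_n(R)\quad\text{for each }i\in\{1,\dots,n-1\},$$ where $p_i(t)=\sum_{j=0}^{i-1}f_jt^{i-j}$.
   Context: Notation: $K_F=K[x]/(F(x,1))$, $\theta$ the image of $x$, $\zeta_i=p_i(\theta)$; $R_F$ = free $R$-module on $1,\zeta_1,\dots,\zeta_{n-1}$ (a ring); $I_F^{n-2}$ = $R$-span of $1,\theta,\dots,\theta^{n-2},\zeta_{n-1}$, with that basis. A based fractional ideal of $R_F$ is an $R_F$-submodule of $K_F$ free of rank $n$ over $R$ with chosen $R$-basis; $\operatorname{N}(I)$ is the determinant of the $K$-linear map sending $1,\zeta_1,\dots,\zeta_{n-1}$ to that basis; $\operatorname{N}(\kappa)$ = determinant of multiplication by $\kappa\in K_F^\times$. $G_n=\operatorname{SL}_n$ ($n$ odd), $\{g:\det g=\pm1\}$ ($n$ even), acting by $g\cdot(A,B)=(gAg^T,gBg^T)$. $H_{F,r}$: classes of pairs $(I,\alpha)$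 with $I$ based fractional ideal, $\alpha\in K_F^\times$, $I^2\subset\alpha I_F^{n-2}$, $\operatorname{N}(I)^2=r\operatorname{N}(\alpha)\operatorname{N}(I_F^{n-2})$, modulo $(I,\alpha)\sim(\kappa I,\kappa^2\alpha)$ ($\kappa\in K_F^\times$, basis scaled) and $G_n(R)$-changes of basis. With $\pi_{n-2},\pi_{n-1}:I_F^{n-2}\to R$ the coordinate functionals given by $\pi_{n-2}(\theta^{n-2})=1$ (zero on the other basis vectors) and $\pi_{n-1}(\zeta_{n-1})=-1$ (zero on the other basis vectors), $\mathsf{orb}_{F,r}(I,\alpha)$ is the $G_n(R)$-orbit of the pair of Gram matrices (in the basis of $I$) of $(\beta,\gamma)\mapsto\pi_{n-1}(\alpha^{-1}\beta\gamma)$ and $(\beta,\gamma)\mapsto\pi_{n-2}(\alpha^{-1}\beta\gamma)$.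
   Formalization: Since the claim fails otherwise, both functionals π_{n-1}, π_{n-2} are multiplied by (-1)^n; for n ≤ 2, π_{n-2} takes the extra value -f_1 (times (-1)^n) on the last basis vector; for n = 1 the basis of I_F^{n-2}, undefined in the text, is taken to be f_0. *)

theory Defs
  imports
    "HOL-Computational_Algebra.Polynomial_Factorial"
    "Jordan_Normal_Form.Determinant"
    "Jordan_Normal_Form.Gauss_Jordan_Elimination"
begin

class principal_ideal_domain = idom +
  assumes ideal_principal:
    "0 \<in> I \<Longrightarrow> (\<forall>x\<in>I. \<forall>y\<in>I. x + y \<in> I) \<Longrightarrow> (\<forall>c. \<forall>x\<in>I. c * x \<in> I)
      \<Longrightarrow> \<exists>a. I = {c * a | c. True}"

text \<open>
  The base ring \<open>R\<close> is a type \<open>'a\<close> and its fraction field \<open>K\<close> is \<open>'a fract\<close>. A binary form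
  \<open>F(x,z)\<close> of degree \<open>n\<close> is given by \<open>n\<close> and its coefficients \<open>f 0, \<dots>, f n\<close>, where
  \<open>f i\<close> belongs to \<open>x^(n-i) z^i\<close>; values \<open>f i\<close> with \<open>i > n\<close> are never used.
\<close>

definition binary_form :: "nat \<Rightarrow> (nat \<Rightarrow> 'b::comm_semiring_1) \<Rightarrow> 'b \<Rightarrow> 'b \<Rightarrow> 'b" where
  "binary_form n f x z = (\<Sum>i\<le>n. f i * x ^ (n - i) * z ^ i)"

text \<open>The ring \<open>K[x,z]\<close> is realised as \<open>K[x][z]\<close>.\<close>

definition constXZ :: "'a::idom fract \<Rightarrow> 'a fract poly poly" where
  "constXZ c = [:[:c:]:]"

definition varX :: "'a::idom fract poly poly" where
  "varX = [:[:0, 1:]:]"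

definition varZ :: "'a::idom fract poly poly" where
  "varZ = [:0, 1:]"


section \<open>The algebra \<open>K[x]/(F(x,1))\<close>\<close>

definition F1 :: "nat \<Rightarrow> (nat \<Rightarrow> 'a::idom) \<Rightarrow> 'a fract poly" where
  "F1 n f = binary_form n (\<lambda>i. [:to_fract (f i):]) [:0, 1:] 1"

definition separable_form :: "nat \<Rightarrow> (nat \<Rightarrow> 'a::idom) \<Rightarrow> bool" where
  "separable_form n f \<longleftrightarrow> coprime (F1 n f) (pderiv (F1 n f))"

text \<open>
  For \<open>n \<ge> 1\<close> and \<open>f 0 \<noteq> 0\<close> each residue class modulo \<open>F(x,1)\<close> has exactly one
  representative of degree less than \<open>n\<close>. Addition and scalar multiplication of the quotient
  are those of polynomials; multiplication is followed by reduction.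
\<close>

definition KF :: "nat \<Rightarrow> 'a::idom fract poly set" where
  "KF n = {u. degree u < n}"

definition KF_mult ::
    "nat \<Rightarrow> (nat \<Rightarrow> 'a::idom) \<Rightarrow> 'a fract poly \<Rightarrow> 'a fract poly \<Rightarrow> 'a fract poly" where
  "KF_mult n f u v = (u * v) mod F1 n f"

definition KF_units :: "nat \<Rightarrow> (nat \<Rightarrow> 'a::idom) \<Rightarrow> 'a fract poly set" where
  "KF_units n f = {u \<in> KF n. \<exists>v \<in> KF n. KF_mult n f u v = 1}"

definition KF_inverse :: "nat \<Rightarrow> (nat \<Rightarrow> 'a::idom) \<Rightarrow> 'a fract poly \<Rightarrow> 'a fract poly" where
  "KF_inverse n f u = (THE v. v \<in> KF n \<and> KF_mult n f u v = 1)"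

definition theta_power :: "nat \<Rightarrow> (nat \<Rightarrow> 'a::idom) \<Rightarrow> nat \<Rightarrow> 'a fract poly" where
  "theta_power n f k = [:0, 1:] ^ k mod F1 n f"

definition zeta :: "nat \<Rightarrow> (nat \<Rightarrow> 'a::idom) \<Rightarrow> nat \<Rightarrow> 'a fract poly" where
  "zeta n f i = (\<Sum>j<i. smult (to_fract (f j)) (theta_power n f (i - j)))"

text \<open>The determinant of multiplication by \<open>\<kappa>\<close>, computed in the basis \<open>1, x, \<dots>, x^(n-1)\<close>.\<close>

definition KF_norm :: "nat \<Rightarrow> (nat \<Rightarrow> 'a::idom) \<Rightarrow> 'a fract poly \<Rightarrow> 'a fract" where
  "KF_norm n f \<kappa> = det (mat n n (\<lambda>(i, j). coeff (KF_mult n f \<kappa> ([:0, 1:] ^ j)) i))"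


section \<open>Based fractional ideals\<close>

text \<open>Families of \<open>n\<close> elements are vectors of dimension \<open>n\<close>.\<close>

definition R_combination :: "'a::idom vec \<Rightarrow> 'a fract poly vec \<Rightarrow> 'a fract poly" where
  "R_combination c b = (\<Sum>k<dim_vec b. smult (to_fract (c $ k)) (b $ k))"

definition R_span :: "'a::idom fract poly vec \<Rightarrow> 'a fract poly set" where
  "R_span b = {R_combination c b | c. c \<in> carrier_vec (dim_vec b)}"

definition RF_basis :: "nat \<Rightarrow> (nat \<Rightarrow> 'a::idom) \<Rightarrow> 'a fract poly vec" where
  "RF_basis n f = vec n (\<lambda>k. if k = 0 then 1 else zeta n f k)"

definition RF :: "nat \<Rightarrow> (nat \<Rightarrow> 'a::idom) \<Rightarrow> 'a fract poly set" where
  "RF n f = R_span (RF_basis n f)"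

definition based_ideal :: "nat \<Rightarrow> (nat \<Rightarrow> 'a::idom) \<Rightarrow> 'a fract poly vec \<Rightarrow> bool" where
  "based_ideal n f b \<longleftrightarrow>
     b \<in> carrier_vec n \<and> (\<forall>k<n. b $ k \<in> KF n) \<and>
     (\<forall>c \<in> carrier_vec n. R_combination c b = 0 \<longrightarrow> c = 0\<^sub>v n) \<and>
     (\<forall>\<rho> \<in> RF n f. \<forall>\<beta> \<in> R_span b. KF_mult n f \<rho> \<beta> \<in> R_span b)"

text \<open>
  The determinant of the \<open>K\<close>-linear map sending \<open>1, \<zeta>\<^sub>1, \<dots>\<close> to \<open>b\<close>: column \<open>k\<close> of the matrix
  holds the coordinates of \<open>b $ k\<close> with respect to \<open>1, \<zeta>\<^sub>1, \<dots>\<close>.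
\<close>

definition ideal_norm :: "nat \<Rightarrow> (nat \<Rightarrow> 'a::idom) \<Rightarrow> 'a fract poly vec \<Rightarrow> 'a fract" where
  "ideal_norm n f b =
     det (THE M. M \<in> carrier_mat n n \<and>
            (\<forall>k<n. b $ k = (\<Sum>j<n. smult (M $$ (j, k)) (RF_basis n f $ j))))"

definition ideal_mult ::
    "nat \<Rightarrow> (nat \<Rightarrow> 'a::idom) \<Rightarrow> 'a fract poly set \<Rightarrow> 'a fract poly set \<Rightarrow> 'a fract poly set" where
  "ideal_mult n f I J =
     {\<Sum>i<m. KF_mult n f (\<beta> i) (\<gamma> i) | (m::nat) \<beta> \<gamma>. \<forall>i<m. \<beta> i \<in> I \<and> \<gamma> i \<in> J}"

text \<open>
  The basis \<open>1, \<theta>, \<dots>, \<theta>^(n-2), \<zeta>\<^bsub>n-1\<^esub>\<close> of \<open>I\<^sub>F^(n-2)\<close>. For \<open>n = 1\<close> there is no power of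
  \<open>\<theta>\<close> in the list and \<open>p\<^sub>0 = 0\<close>; the single basis vector of \<open>I\<^sub>F^(-1)\<close> is then \<open>f 0\<close>, so that
  \<open>N(I\<^sub>F^(n-2)) = f 0 ^ (2 - n)\<close> for all \<open>n \<ge> 1\<close>.
\<close>

definition IF_basis :: "nat \<Rightarrow> (nat \<Rightarrow> 'a::idom) \<Rightarrow> 'a fract poly vec" where
  "IF_basis n f =
     vec n (\<lambda>k. if k + 1 < n then theta_power n f k
                else if n = 1 then [:to_fract (f 0):] else zeta n f (n - 1))"

definition IF :: "nat \<Rightarrow> (nat \<Rightarrow> 'a::idom) \<Rightarrow> 'a fract poly set" where
  "IF n f = R_span (IF_basis n f)"


section \<open>The group \<open>G\<^sub>n(R)\<close>, the set \<open>H\<^bsub>F,r\<^esub>\<close> and the map to orbits\<close>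

definition Gn :: "nat \<Rightarrow> 'a::idom mat set" where
  "Gn n = {g \<in> carrier_mat n n. if odd n then det g = 1 else det g = 1 \<or> det g = - 1}"

definition Gn_orbit :: "nat \<Rightarrow> 'a::idom mat \<times> 'a mat \<Rightarrow> ('a mat \<times> 'a mat) set" where
  "Gn_orbit n = (\<lambda>(A, B). {(g * A * transpose_mat g, g * B * transpose_mat g) | g. g \<in> Gn n})"

definition scale_basis ::
    "nat \<Rightarrow> (nat \<Rightarrow> 'a::idom) \<Rightarrow> 'a fract poly \<Rightarrow> 'a fract poly vec \<Rightarrow> 'a fract poly vec" where
  "scale_basis n f \<kappa> b = map_vec (KF_mult n f \<kappa>) b"

definition change_basis :: "'a::idom mat \<Rightarrow> 'a fract poly vec \<Rightarrow> 'a fract poly vec" where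
  "change_basis g b = vec (dim_row g) (\<lambda>i. R_combination (row g i) b)"

definition H_pairs ::
    "nat \<Rightarrow> (nat \<Rightarrow> 'a::idom) \<Rightarrow> 'a \<Rightarrow> ('a fract poly vec \<times> 'a fract poly) set" where
  "H_pairs n f r =
     {(b, \<alpha>). based_ideal n f b \<and> \<alpha> \<in> KF_units n f \<and>
        ideal_mult n f (R_span b) (R_span b) \<subseteq> KF_mult n f \<alpha> ` IF n f \<and>
        (ideal_norm n f b)\<^sup>2 = to_fract r * KF_norm n f \<alpha> * ideal_norm n f (IF_basis n f)}"

definition H_rel ::
    "nat \<Rightarrow> (nat \<Rightarrow> 'a::idom) \<Rightarrow> 'a
      \<Rightarrow> (('a fract poly vec \<times> 'a fract poly) \<times> ('a fract poly vec \<times> 'a fract poly)) set" where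
  "H_rel n f r =
     {((b, \<alpha>), (b', \<alpha>')). (b, \<alpha>) \<in> H_pairs n f r \<and> (b', \<alpha>') \<in> H_pairs n f r \<and>
        (\<exists>\<kappa> \<in> KF_units n f. \<exists>g \<in> Gn n.
           b' = change_basis g (scale_basis n f \<kappa> b) \<and>
           \<alpha>' = KF_mult n f (KF_mult n f \<kappa> \<kappa>) \<alpha>)}"

definition H_set ::
    "nat \<Rightarrow> (nat \<Rightarrow> 'a::idom) \<Rightarrow> 'a \<Rightarrow> ('a fract poly vec \<times> 'a fract poly) set set" where
  "H_set n f r = H_pairs n f r // H_rel n f r"

definition IF_coords :: "nat \<Rightarrow> (nat \<Rightarrow> 'a::idom) \<Rightarrow> 'a fract poly \<Rightarrow> 'a vec" where
  "IF_coords n f \<delta> = (THE c. c \<in> carrier_vec n \<and> R_combination c (IF_basis n f) = \<delta>)"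

text \<open>
  The functionals \<open>\<pi>\<^bsub>n-1\<^esub>\<close> and \<open>\<pi>\<^bsub>n-2\<^esub>\<close> on \<open>I\<^sub>F^(n-2)\<close>. For even \<open>n \<ge> 4\<close> they are given by
  \<open>\<pi>\<^bsub>n-1\<^esub>(\<zeta>\<^bsub>n-1\<^esub>) = -1\<close> and \<open>\<pi>\<^bsub>n-2\<^esub>(\<theta>^(n-2)) = 1\<close>, and zero on the other basis vectors.

  The factor \<open>(-1)^n\<close> negates both for odd \<open>n\<close>. Without it the Gram matrices \<open>(A, B)\<close> of
  \<open>(I, \<alpha>)\<close> satisfy \<open>(-1)^(n div 2) det(xA + zB) = (-1)^n (r / f 0) F(x, f 0 z)\<close>, so for odd
  \<open>n\<close> the pairs with invariant form \<open>(r / f 0) F(x, f 0 z)\<close> would not be attained.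

  For \<open>n \<ge> 3\<close> one has \<open>\<pi>\<^bsub>n-2\<^esub>(\<delta>) = - \<pi>\<^bsub>n-1\<^esub>(f 0 \<theta> \<delta>)\<close>, which makes \<open>- A\<^sup>-\<^sup>1 B\<close> the matrix of
  multiplication by \<open>f 0 \<theta>\<close>. For \<open>n \<le> 2\<close> this identity requires the extra term \<open>f 1\<close> below,
  because \<open>\<theta> \<zeta>\<^bsub>n-1\<^esub>\<close> then has in general a component along \<open>\<zeta>\<^bsub>n-1\<^esub>\<close> (for \<open>n = 1\<close>, along the basis
  vector \<open>f 0\<close>, and it says that \<open>\<pi>\<^bsub>-1\<^esub>(\<theta>^(-1)) = (-1)^n\<close> when \<open>\<theta> \<noteq> 0\<close>).
\<close>

definition pi_last :: "nat \<Rightarrow> (nat \<Rightarrow> 'a::idom) \<Rightarrow> 'a fract poly \<Rightarrow> 'a" where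
  "pi_last n f \<delta> = (- 1) ^ n * (- (IF_coords n f \<delta> $ (n - 1)))"

definition pi_prev :: "nat \<Rightarrow> (nat \<Rightarrow> 'a::idom) \<Rightarrow> 'a fract poly \<Rightarrow> 'a" where
  "pi_prev n f \<delta> =
     (- 1) ^ n * ((if n \<ge> 2 then IF_coords n f \<delta> $ (n - 2) else 0)
                  - (if n \<le> 2 then f 1 * IF_coords n f \<delta> $ (n - 1) else 0))"

definition gram ::
    "nat \<Rightarrow> (nat \<Rightarrow> 'a::idom) \<Rightarrow> ('a fract poly \<Rightarrow> 'a) \<Rightarrow> 'a fract poly vec \<Rightarrow> 'a fract poly \<Rightarrow> 'a mat"
  where
  "gram n f \<pi> b \<alpha> =
     mat n n (\<lambda>(i, j). \<pi> (KF_mult n f (KF_inverse n f \<alpha>) (KF_mult n f (b $ i) (b $ j))))"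

text \<open>
  On classes: all representatives give the same orbit, so the union is that orbit.
\<close>

definition orb ::
    "nat \<Rightarrow> (nat \<Rightarrow> 'a::idom) \<Rightarrow> ('a fract poly vec \<times> 'a fract poly) set \<Rightarrow> ('a mat \<times> 'a mat) set"
  where
  "orb n f C = (\<Union>(b, \<alpha>) \<in> C. Gn_orbit n (gram n f (pi_last n f) b \<alpha>, gram n f (pi_prev n f) b \<alpha>))"


section \<open>The integrality condition\<close>

definition p_mat :: "nat \<Rightarrow> (nat \<Rightarrow> 'a::idom) \<Rightarrow> nat \<Rightarrow> 'a fract mat \<Rightarrow> 'a fract mat" where
  "p_mat n f i T =
     mat n n (\<lambda>(a, b). \<Sum>j<i. to_fract (f j) * (T ^\<^sub>m (i - j)) $$ (a, b))"

definition integral_mats :: "nat \<Rightarrow> 'a::idom fract mat set" where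
  "integral_mats n = map_mat to_fract ` carrier_mat n n"

end

theory Submission
  imports Defs "Jordan_Normal_Form.Char_Poly"
begin

text \<open>
  Put \<open>\<pi>\<^bsub>n-1\<^esub> = \<phi>\<close>, a nondegenerate linear functional on \<open>K\<^sub>F\<close>; then \<open>\<pi>\<^bsub>n-2\<^esub>(\<delta>) = \<phi>(- f\<^sub>0 \<theta> \<delta>)\<close>. Hence if
  \<open>(A, B)\<close> is the pair of Gram matrices of \<open>(I, \<alpha>)\<close>, the matrix \<open>T = - A\<^sup>-\<^sup>1 B / f\<^sub>0\<close> describes
  multiplication by \<open>\<theta>\<close> in the basis of \<open>I\<close>, so \<open>p\<^sub>i(T)\<close> describes multiplication by \<open>\<zeta>\<^sub>i\<close>, which
  preserves \<open>I\<close>.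

  Conversely, \<open>T\<close> has the squarefree characteristic polynomial \<open>F(x,1) / f\<^sub>0\<close>, so \<open>K\<^sup>n\<close> is a cyclic
  \<open>K[T]\<close>-module and is identified with \<open>K\<^sub>F\<close>. As \<open>A\<close> and \<open>A T\<close> are symmetric, the form \<open>A\<close> becomes
  \<open>(\<beta>, \<beta>') \<mapsto> \<phi>(\<gamma> \<beta> \<beta>')\<close> for a unit \<open>\<gamma> = \<alpha>\<^sup>-\<^sup>1\<close>. Integrality of \<open>p\<^sub>i(T)\<close> makes the image \<open>I\<close> of \<open>R\<^sup>n\<close> an
  \<open>R\<^sub>F\<close>-module, and gives \<open>I\<^sup>2 \<subseteq> \<alpha> I\<^sub>F^(n-2)\<close> because the coordinates of \<open>\<delta>\<close> with respect to the basis of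
  \<open>I\<^sub>F^(n-2)\<close> are read off from \<open>\<phi>(\<delta>)\<close> and the values \<open>\<phi>(\<delta> \<zeta>\<^sub>m)\<close>. The norm condition is the determinant of
  the relation between \<open>A\<close> and the Hankel matrix \<open>(\<phi>(\<theta>\<^bsup>i+j\<^esup>))\<close>.
\<close>

section \<open>Determinants of anti-triangular matrices\<close>

text \<open>Expansion along the first row leaves only its last entry. The cofactor signs multiply to
  (-1)^(n(n-1)/2), which equals \<open>(- 1) ^ (n div 2)\<close>; applied to the Hankel matrix of
  \<open>phi\<close>, this produces the sign in front of the invariant form.\<close>

lemma det_anti_triangular:
  fixes M :: "'b::comm_ring_1 mat"
  assumes "M \<in> carrier_mat n n"
    and "\<And>i j. i + j + 1 < n \<Longrightarrow> M $$ (i, j) = 0"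
    and "\<And>i j. i + j + 1 = n \<Longrightarrow> M $$ (i, j) = c"
  shows "det M = (- 1) ^ (n div 2) * c ^ n"
  using assms
proof (induction n arbitrary: M)
  case 0
  then show ?case by simp
next
  case (Suc m)
  have M: "M \<in> carrier_mat (Suc m) (Suc m)" by (rule Suc.prems(1))
  have D: "mat_delete M 0 m \<in> carrier_mat m m"
    using mat_delete_carrier[OF M] by simp
  have ent: "mat_delete M 0 m $$ (i, j) = M $$ (Suc i, j)" if "i < m" "j < m" for i j
    using that M by (simp add: mat_delete_def)
  have "det (mat_delete M 0 m) = (- 1) ^ (m div 2) * c ^ m"
  proof (rule Suc.IH[OF D])
    show "mat_delete M 0 m $$ (i, j) = 0" if "i + j + 1 < m" for i j
      using that by (subst ent) (auto intro!: Suc.prems(2))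
    show "mat_delete M 0 m $$ (i, j) = c" if "i + j + 1 = m" for i j
      using that by (subst ent) (auto intro!: Suc.prems(3))
  qed
  moreover have "det M = (\<Sum>j<Suc m. M $$ (0, j) * cofactor M 0 j)"
    by (rule laplace_expansion_row[OF M]) simp
  moreover have "\<dots> = M $$ (0, m) * cofactor M 0 m"
    by (simp add: Suc.prems(2))
  moreover have "M $$ (0, m) = c" by (rule Suc.prems(3)) simp
  moreover have "(- 1 :: 'b) ^ m * (- 1) ^ (m div 2) = (- 1) ^ (Suc m div 2)"
    by (cases "even m") (auto elim!: evenE oddE simp: power_add)
  ultimately show ?case
    by (simp add: cofactor_def mult_ac)
qed

subsection \<open>Cyclic vectors\<close>

lemma prime_divisor_exists:
  fixes d :: "'k::field poly"
  assumes "d \<noteq> 0" "degree d \<noteq> 0"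
  obtains p where "prime_elem p" "p dvd d"
proof -
  have "\<exists>p. irreducible p \<and> p dvd d"
    using assms
  proof (induction "degree d" arbitrary: d rule: less_induct)
    case less
    show ?case
    proof (cases "irreducible d")
      case False
      have "\<not> d dvd 1" using less.prems by (auto simp: is_unit_iff_degree)
      with False less.prems obtain a e where ae: "d = a * e" "\<not> a dvd 1" "\<not> e dvd 1"
        by (auto simp: irreducible_def)
      with less.prems have nz: "a \<noteq> 0" "e \<noteq> 0" by auto
      with ae have "degree a \<noteq> 0" "degree e \<noteq> 0" by (auto simp: is_unit_iff_degree)
      with ae nz have "degree a < degree d" by (simp add: degree_mult_eq)
      from less.hyps[OF this nz(1) \<open>degree a \<noteq> 0\<close>] ae show ?thesis
        by (auto intro: dvd_trans dvd_triv_left)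
    qed auto
  qed
  then show ?thesis
    using that field_poly_irreducible_imp_prime by blast
qed

text \<open>In \<open>p * d = q * t\<close> the prime \<open>p\<close> must divide \<open>t\<close>,
  and then it cancels.\<close>

lemma dvd_cancel_prime_elem:
  fixes p :: "'k::field poly"
  assumes "prime_elem p" "\<not> p dvd q" "q dvd p * d"
  shows "q dvd d"
proof -
  from assms(3) obtain t where t: "p * d = q * t" by (auto simp: dvd_def)
  then have "p dvd q * t" by (metis dvd_triv_left)
  with assms have "p dvd t" by (auto simp: prime_elem_dvd_mult_iff)
  then obtain s where "t = p * s" by (auto simp: dvd_def)
  with t have "p * d = p * (q * s)" by (simp add: mult_ac)
  with assms(1) have "d = q * s" by (simp add: prime_elem_def)
  then show ?thesis by simp
qed

text \<open>The row \<open>b\<close> is a left eigenvector of \<open>T\<close> with eigenvalue x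
  modulo the characteristic polynomial. Equivalently, sending the k-th unit vector to
  \<open>b k\<close> is a homomorphism of K[x]-modules from K^n, where x acts as \<open>T\<close>,
  to K[x]/(\<open>char_poly T\<close>).\<close>

definition left_eigen :: "nat \<Rightarrow> 'k::field mat \<Rightarrow> (nat \<Rightarrow> 'k poly) \<Rightarrow> bool" where
  "left_eigen n T b \<longleftrightarrow>
     (\<forall>k<n. char_poly T dvd [:0, 1:] * b k - (\<Sum>j<n. smult (T $$ (j, k)) (b j)))"

lemma left_eigen_add_mult:
  assumes "left_eigen n T b" "left_eigen n T u"
  shows "left_eigen n T (\<lambda>k. b k + s * u k)"
  unfolding left_eigen_def
proof (intro allI impI)
  fix k assume k: "k < n"
  have "[:0, 1:] * (b k + s * u k) - (\<Sum>j<n. smult (T $$ (j, k)) (b j + s * u j))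
      = ([:0, 1:] * b k - (\<Sum>j<n. smult (T $$ (j, k)) (b j)))
        + s * ([:0, 1:] * u k - (\<Sum>j<n. smult (T $$ (j, k)) (u j)))"
    by (simp add: algebra_simps smult_add_right sum.distrib sum_distrib_left)
  then show "char_poly T dvd [:0, 1:] * (b k + s * u k)
      - (\<Sum>j<n. smult (T $$ (j, k)) (b j + s * u j))"
    using assms k unfolding left_eigen_def by (simp only: dvd_add dvd_mult)
qed

text \<open>The adjugate of xI - T times xI - T is \<open>char_poly T\<close> times the identity, so
  every row of the adjugate is killed by xI - T modulo \<open>char_poly T\<close>.\<close>

lemma left_eigen_adj_row:
  assumes T: "T \<in> carrier_mat n n" and i: "i < n"
  shows "left_eigen n T (\<lambda>k. adj_mat (char_poly_matrix T) $$ (i, k))"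
  unfolding left_eigen_def
proof (intro allI impI)
  fix k assume k: "k < n"
  let ?C = "char_poly_matrix T" and ?D = "adj_mat (char_poly_matrix T)"
  have C: "?C \<in> carrier_mat n n" using T by simp
  note D = adj_mat[OF C]
  have "(?D * ?C) $$ (i, k) = (\<Sum>j<n. ?D $$ (i, j) * ?C $$ (j, k))"
    using D(1) C i k by (simp add: scalar_prod_def lessThan_atLeast0)
  also have "\<dots> = (\<Sum>j<n. (if j = k then [:0, 1:] * ?D $$ (i, j) else 0)
                      - smult (T $$ (j, k)) (?D $$ (i, j)))"
    using T k by (intro sum.cong refl) (auto simp: char_poly_matrix_def algebra_simps)
  also have "\<dots> = [:0, 1:] * ?D $$ (i, k) - (\<Sum>j<n. smult (T $$ (j, k)) (?D $$ (i, j)))"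
    using k by (simp add: sum_subtractf)
  finally have eq: "(?D * ?C) $$ (i, k)
      = [:0, 1:] * ?D $$ (i, k) - (\<Sum>j<n. smult (T $$ (j, k)) (?D $$ (i, j)))" .
  have "char_poly T dvd (?D * ?C) $$ (i, k)"
    using i k by (simp add: D(3) char_poly_def del: index_mult_mat)
  then show "char_poly T dvd [:0, 1:] * ?D $$ (i, k)
      - (\<Sum>j<n. smult (T $$ (j, k)) (?D $$ (i, j)))"
    by (simp only: eq)
qed

text \<open>If \<open>p\<close> divided all entries of the adjugate, then \<open>p ^ n\<close> would divide its determinant
  \<open>\<chi> ^ (n - 1)\<close>.\<close>

lemma adj_char_poly_matrix_not_dvd:
  fixes T :: "'k::field mat"
  assumes T: "T \<in> carrier_mat n n" and n: "n \<ge> 1"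
    and p: "prime_elem p" "p dvd char_poly T" "\<not> p * p dvd char_poly T"
  shows "\<exists>i<n. \<exists>k<n. \<not> p dvd adj_mat (char_poly_matrix T) $$ (i, k)"
proof (rule ccontr)
  let ?C = "char_poly_matrix T" and ?D = "adj_mat (char_poly_matrix T)" and ?\<chi> = "char_poly T"
  assume "\<not> ?thesis"
  then have dvd: "p dvd ?D $$ (i, k)" if "i < n" "k < n" for i k using that by auto
  have C: "?C \<in> carrier_mat n n" using T by simp
  note D = adj_mat[OF C]
  define E where "E = mat n n (\<lambda>(i, k). ?D $$ (i, k) div p)"
  have "?D = p \<cdot>\<^sub>m E"
    using D(1) dvd by (intro eq_matI) (auto simp: E_def)
  then have detD: "det ?D = p ^ n * det E"
    by (metis E_def det_smult dim_col_mat(1))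
  have "?\<chi> * det ?D = ?\<chi> ^ n"
    using arg_cong[OF D(2), of det] det_mult[OF C D(1)] by (simp add: char_poly_def)
  moreover have chi0: "?\<chi> \<noteq> 0" using degree_monic_char_poly[OF T] by auto
  ultimately have "det ?D = ?\<chi> ^ (n - 1)"
    using n by (cases n) auto
  \<comment> \<open>Cancelling p^(n-1) in det(adj) = (pq)^(n-1) leaves q^(n-1) = p det(E), so
    \<open>p\<close> divides \<open>q\<close> and \<open>p * p\<close> divides the characteristic
    polynomial.\<close>
  moreover obtain q where q: "?\<chi> = p * q" using p(2) by (auto simp: dvd_def)
  ultimately have "p ^ n * det E = p ^ (n - 1) * q ^ (n - 1)"
    using detD by (simp add: power_mult_distrib)
  then have "p ^ (n - 1) * (p * det E) = p ^ (n - 1) * q ^ (n - 1)"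
    using n by (cases n) (auto simp: mult_ac)
  moreover have "p \<noteq> 0" using p(1) by auto
  ultimately have "q ^ (n - 1) = p * det E" by simp
  then have "p dvd q ^ (n - 1)" by simp
  then have "p dvd q" using p(1) prime_elem_dvd_power by blast
  with p(3) q show False by simp
qed

text \<open>Starting from the zero row, the primes dividing all entries are removed one at a time.
  For such a prime p, a suitable row of the adjugate is added after multiplication by \<chi>/p: this
  destroys divisibility by p, because \<chi> is squarefree, and does not affect divisibility by the
  divisors of \<chi>/p.\<close>

lemma left_eigen_coprime_exists:
  fixes T :: "'k::field mat"
  assumes T: "T \<in> carrier_mat n n" and n: "n \<ge> 1"
    and sf: "\<And>p. prime_elem p \<Longrightarrow> \<not> p * p dvd char_poly T"
  obtains b where "left_eigen n T b"
    "\<And>q. q dvd char_poly T \<Longrightarrow> (\<forall>k<n. q dvd b k) \<Longrightarrow> q dvd 1"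
proof -
  let ?\<chi> = "char_poly T"
  \<comment> \<open>Here \<open>d\<close> is a divisor of \<chi> that bounds, for divisibility, the
    common divisors of \<chi> and the entries of \<open>b\<close>. The induction lowers its degree
    from \<open>d = ?\<chi>\<close>, \<open>b = 0\<close> down to \<open>d = 1\<close>.\<close>
  define good where "good d b \<longleftrightarrow> d dvd ?\<chi> \<and> left_eigen n T b \<and>
    (\<forall>q. q dvd ?\<chi> \<longrightarrow> (\<forall>k<n. q dvd b k) \<longrightarrow> q dvd d)" for d b
  have chi0: "?\<chi> \<noteq> 0" using degree_monic_char_poly[OF T] by auto
  have "\<exists>b. good 1 b" if "good d b" for d b
    using that
  proof (induction "degree d" arbitrary: d b rule: less_induct)
    case less
    have d0: "d \<noteq> 0" using less.prems chi0 by (auto simp: good_def)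
    show ?case
    proof (cases "degree d = 0")
      case True
      with d0 have "d dvd 1" by (simp add: is_unit_iff_degree)
      with less.prems have "good 1 b" unfolding good_def by (meson dvd_trans one_dvd)
      then show ?thesis by blast
    next
      case False
      with d0 obtain p where p: "prime_elem p" "p dvd d" by (rule prime_divisor_exists)
      then obtain d' where d': "d = p * d'" by (auto simp: dvd_def)
      have p\<chi>: "p dvd ?\<chi>" using p less.prems by (auto simp: good_def intro: dvd_trans)
      then obtain e where e: "?\<chi> = p * e" by (auto simp: dvd_def)
      have pe: "\<not> p dvd e" using sf[OF p(1)] e by auto
      have deg: "degree d' < degree d"
      proof -
        have "d' \<noteq> 0" "p \<noteq> 0" using d0 d' by auto
        moreover have "degree p \<noteq> 0"
          using p(1) \<open>p \<noteq> 0\<close> by (auto simp: prime_elem_def is_unit_iff_degree)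
        ultimately show ?thesis by (simp add: d' degree_mult_eq)
      qed
      have d'\<chi>: "d' dvd ?\<chi>" using less.prems d' by (auto simp: good_def intro: dvd_trans[of _ d])
      have "\<exists>b'. left_eigen n T b' \<and> (\<exists>k<n. \<not> p dvd b' k) \<and>
          (\<forall>q. q dvd e \<longrightarrow> (\<forall>k<n. q dvd b' k) \<longrightarrow> (\<forall>k<n. q dvd b k))"
      proof (cases "\<forall>k<n. p dvd b k")
        case True
        obtain i k where ik: "i < n" "k < n" "\<not> p dvd adj_mat (char_poly_matrix T) $$ (i, k)"
          using adj_char_poly_matrix_not_dvd[OF T n p(1) p\<chi> sf[OF p(1)]] by blast
        define u where "u = (\<lambda>k. adj_mat (char_poly_matrix T) $$ (i, k))"
        have "left_eigen n T (\<lambda>k. b k + e * u k)"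
          using less.prems left_eigen_adj_row[OF T ik(1)] unfolding u_def
          by (intro left_eigen_add_mult) (auto simp: good_def)
        moreover have "\<not> p dvd b k + e * u k"
          using True ik p(1) pe by (simp add: dvd_add_right_iff prime_elem_dvd_mult_iff u_def)
        moreover have "q dvd b l" if "q dvd e" "\<forall>k<n. q dvd b k + e * u k" "l < n" for q l
          using that by (metis dvd_add_left_iff dvd_mult2)
        ultimately show ?thesis using ik(2) by (intro exI[of _ "\<lambda>k. b k + e * u k"]) blast
      next
        case False
        then show ?thesis using less.prems by (auto simp: good_def)
      qed
      then obtain b' where b': "left_eigen n T b'" "\<exists>k<n. \<not> p dvd b' k"
        "\<And>q. q dvd e \<Longrightarrow> (\<forall>k<n. q dvd b' k) \<Longrightarrow> (\<forall>k<n. q dvd b k)" by blast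
      have "good d' b'"
        unfolding good_def
      proof (intro conjI allI impI)
        fix q assume q: "q dvd ?\<chi>" "\<forall>k<n. q dvd b' k"
        \<comment> \<open>Some entry of \<open>b'\<close> is not divisible by \<open>p\<close>, so
          \<open>p\<close> cannot divide \<open>q\<close>; hence \<open>q\<close>, a divisor of
          \<chi> = pe, divides \<open>e\<close>, where \<open>b'\<close> gives no common divisors
          beyond those of \<open>b\<close>.\<close>
        then have pq: "\<not> p dvd q" using b'(2) by (meson dvd_trans)
        then have qe: "q dvd e" using q(1) p(1) e by (metis dvd_cancel_prime_elem)
        with b'(3) q have "\<forall>k<n. q dvd b k" by blast
        then have "q dvd p * d'" using less.prems q(1) d' by (auto simp: good_def)
        then show "q dvd d'" using p(1) pq by (metis dvd_cancel_prime_elem)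
      qed (use d'\<chi> b' in auto)
      from less.hyps[OF deg this] show ?thesis .
    qed
  qed
  moreover have "good ?\<chi> (\<lambda>_. 0)" by (simp add: good_def left_eigen_def)
  ultimately obtain b where "good 1 b" by blast
  then show ?thesis using that by (auto simp: good_def)
qed

text \<open>Division with remainder shows that a nonzero element of least degree divides all of
  \<open>J\<close>; by the hypothesis on common divisors it is a unit.\<close>

lemma ideal_with_unit_divisors_is_UNIV:
  fixes J :: "'k::field poly set"
  assumes add: "\<And>u v. u \<in> J \<Longrightarrow> v \<in> J \<Longrightarrow> u + v \<in> J"
    and mult: "\<And>s u. u \<in> J \<Longrightarrow> s * u \<in> J"
    and g: "g \<in> J" "g \<noteq> 0"
    and unit: "\<And>q. (\<forall>u\<in>J. q dvd u) \<Longrightarrow> q dvd 1"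
  shows "u \<in> J"
proof -
  obtain d where d: "d \<in> J" "d \<noteq> 0" "\<And>v. v \<in> J \<Longrightarrow> v \<noteq> 0 \<Longrightarrow> degree d \<le> degree v"
    using ex_has_least_nat[of "\<lambda>d. d \<in> J \<and> d \<noteq> 0" g degree] g by blast
  have "d dvd v" if "v \<in> J" for v
  proof -
    have "v mod d = v + (- (v div d)) * d" by (simp add: minus_mult_div_eq_mod[symmetric] mult.commute)
    then have "v mod d \<in> J" using that d(1) add mult by metis
    then show ?thesis using d(2,3) degree_mod_less'[of d v] by (metis dvd_eq_mod_eq_0 not_less)
  qed
  then have "d dvd 1" using unit by blast
  then obtain t where "1 = d * t" by (auto simp: dvd_def)
  then have "u = (u * t) * d" by (metis mult.assoc mult.commute mult_1_right)
  with mult d(1) show ?thesis by metis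
qed

text \<open>The polynomials congruent modulo \<chi> to a K-combination of the entries of
  \<open>b\<close> form an ideal, which contains \<chi> and the entries. For \<open>b\<close> from
  \<open>left_eigen_coprime_exists\<close> these have only units as common divisors, so the ideal is
  everything and the module homomorphism to K[x]/(\<chi>) is onto.\<close>

lemma left_eigen_basis_exists:
  fixes T :: "'k::field mat"
  assumes T: "T \<in> carrier_mat n n" and n: "n \<ge> 1"
    and sf: "\<And>p. prime_elem p \<Longrightarrow> \<not> p * p dvd char_poly T"
  obtains b where "left_eigen n T b"
    "\<And>u. \<exists>c. char_poly T dvd u - (\<Sum>k<n. smult (c k) (b k))"
proof -
  let ?\<chi> = "char_poly T"
  obtain b where b: "left_eigen n T b"
    and cop: "\<And>q. q dvd ?\<chi> \<Longrightarrow> (\<forall>k<n. q dvd b k) \<Longrightarrow> q dvd 1"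
    using left_eigen_coprime_exists[OF assms] by blast
  define J where "J = {u. \<exists>c. ?\<chi> dvd u - (\<Sum>k<n. smult (c k) (b k))}"
  have JI: "u \<in> J" if "?\<chi> dvd u - (\<Sum>k<n. smult (c k) (b k))" for u c
    using that unfolding J_def by (intro CollectI exI)
  have add: "u + v \<in> J" if uv: "u \<in> J" "v \<in> J" for u v
  proof -
    from uv obtain c d where cd: "?\<chi> dvd u - (\<Sum>k<n. smult (c k) (b k))"
      "?\<chi> dvd v - (\<Sum>k<n. smult (d k) (b k))" by (auto simp: J_def)
    have "u + v - (\<Sum>k<n. smult (c k + d k) (b k))
        = (u - (\<Sum>k<n. smult (c k) (b k))) + (v - (\<Sum>k<n. smult (d k) (b k)))"
      by (simp add: smult_add_left sum.distrib)
    with dvd_add[OF cd] have "?\<chi> dvd u + v - (\<Sum>k<n. smult (c k + d k) (b k))" by (simp only:)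
    then show ?thesis by (rule JI)
  qed
  have scale: "smult a u \<in> J" if "u \<in> J" for a u
  proof -
    from that obtain c where c: "?\<chi> dvd u - (\<Sum>k<n. smult (c k) (b k))" by (auto simp: J_def)
    have "smult a u - (\<Sum>k<n. smult (a * c k) (b k)) = smult a (u - (\<Sum>k<n. smult (c k) (b k)))"
      by (simp add: smult_diff_right smult_sum2)
    with dvd_smult[OF c] have "?\<chi> dvd smult a u - (\<Sum>k<n. smult (a * c k) (b k))" by (simp only:)
    then show ?thesis by (rule JI)
  qed
  have shift: "[:0, 1:] * u \<in> J" if "u \<in> J" for u
  proof -
    from that obtain c where c: "?\<chi> dvd u - (\<Sum>k<n. smult (c k) (b k))" by (auto simp: J_def)
    \<comment> \<open>Multiplication by x turns the coefficient vector \<open>c\<close> into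
      \<open>T\<close> applied to \<open>c\<close>.\<close>
    let ?d = "\<lambda>j. \<Sum>k<n. c k * T $$ (j, k)"
    have "[:0, 1:] * u - (\<Sum>j<n. smult (?d j) (b j))
        = [:0, 1:] * (u - (\<Sum>k<n. smult (c k) (b k)))
          + (\<Sum>k<n. smult (c k) ([:0, 1:] * b k - (\<Sum>j<n. smult (T $$ (j, k)) (b j))))"
    proof -
      have "(\<Sum>j<n. smult (?d j) (b j)) = (\<Sum>k<n. smult (c k) (\<Sum>j<n. smult (T $$ (j, k)) (b j)))"
        by (simp add: smult_sum smult_sum2) (rule sum.swap)
      moreover have "[:0, 1:] * (\<Sum>k<n. smult (c k) (b k)) = (\<Sum>k<n. smult (c k) ([:0, 1:] * b k))"
        by (simp add: sum_distrib_left del: mult_pCons_left)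
      ultimately show ?thesis
        by (simp add: right_diff_distrib smult_diff_right sum_subtractf del: mult_pCons_left)
    qed
    moreover have "?\<chi> dvd (\<Sum>k<n. smult (c k) ([:0, 1:] * b k - (\<Sum>j<n. smult (T $$ (j, k)) (b j))))"
      using b by (intro dvd_sum dvd_smult) (auto simp: left_eigen_def)
    ultimately have "?\<chi> dvd [:0, 1:] * u - (\<Sum>j<n. smult (?d j) (b j))"
      using dvd_mult[OF c] by (simp only: dvd_add)
    then show ?thesis by (rule JI)
  qed
  have mult: "s * u \<in> J" if "u \<in> J" for s u
  proof (induction s)
    case 0
    have "?\<chi> dvd 0 - (\<Sum>k<n. smult 0 (b k))" by simp
    then show ?case using JI[of 0 "\<lambda>_. 0"] by simp
  next
    case (pCons a s)
    have "pCons a s * u = smult a u + [:0, 1:] * (s * u)" by simp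
    then show ?case using add[OF scale[OF that] shift[OF pCons.IH]] by metis
  qed
  have "?\<chi> dvd ?\<chi> - (\<Sum>k<n. smult 0 (b k))" by simp
  then have chiJ: "?\<chi> \<in> J" by (rule JI)
  have bJ: "b k \<in> J" if "k < n" for k
  proof -
    have "(\<Sum>l<n. smult (if l = k then 1 else 0) (b l)) = (\<Sum>l<n. if l = k then b l else 0)"
      by (intro sum.cong) auto
    then have "?\<chi> dvd b k - (\<Sum>l<n. smult (if l = k then 1 else 0) (b l))" using that by simp
    then show ?thesis by (rule JI)
  qed
  have chi0: "?\<chi> \<noteq> 0" using degree_monic_char_poly[OF T] by auto
  have unit: "q dvd 1" if "\<forall>u\<in>J. q dvd u" for q
    using that chiJ bJ by (intro cop) blast+
  have "u \<in> J" for u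
    by (rule ideal_with_unit_divisors_is_UNIV[OF add mult chiJ chi0 unit])
  then have "\<exists>c. ?\<chi> dvd u - (\<Sum>k<n. smult (c k) (b k))" for u
    unfolding J_def by (rule CollectD)
  with b show ?thesis by (rule that)
qed

subsection \<open>Multiplication matrices and the functional \<open>\<phi>\<close>\<close>

lemma index_mult_mat_sum:
  assumes "A \<in> carrier_mat n m" "B \<in> carrier_mat m l" "i < n" "j < l"
  shows "(A * B) $$ (i, j) = (\<Sum>k<m. A $$ (i, k) * B $$ (k, j))"
  using assms by (simp add: scalar_prod_def lessThan_atLeast0)

lemma coeff_F1: "coeff (F1 n f) k = (if k \<le> n then to_fract (f (n - k)) else 0)"
proof -
  have "F1 n f = (\<Sum>i\<le>n. monom (to_fract (f i)) (n - i))"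
    by (simp add: F1_def binary_form_def monom_altdef)
  then have "coeff (F1 n f) k = (\<Sum>i\<le>n. if n - i = k then to_fract (f i) else 0)"
    by (simp add: coeff_sum)
  also have "\<dots> = (\<Sum>i\<le>n. if i = n - k then (if k \<le> n then to_fract (f (n - k)) else 0) else 0)"
    by (intro sum.cong) auto
  finally show ?thesis by simp
qed

locale form_algebra =
  fixes n :: nat and f :: "nat \<Rightarrow> 'a::idom"
  assumes n_pos: "n \<ge> 1" and f0_nz [simp]: "f 0 \<noteq> 0"
begin

abbreviation N :: "'a fract poly" where "N \<equiv> F1 n f"
abbreviation X :: "'a fract poly" where "X \<equiv> [:0, 1:]"
abbreviation F0 :: "'a fract" where "F0 \<equiv> to_fract (f 0)"

lemma degree_N: "degree N = n"
proof (rule antisym)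
  show "degree N \<le> n" by (rule degree_le) (simp add: coeff_F1)
  show "n \<le> degree N" by (rule le_degree) (simp add: coeff_F1)
qed

lemma N_nz [simp]: "N \<noteq> 0"
  using degree_N n_pos by auto

lemma mod_N_degree: "degree (u mod N) < n"
  using degree_mod_less[of N u] degree_N n_pos by auto

lemma mod_N_eq: "degree u < n \<Longrightarrow> u mod N = u"
  by (simp add: mod_poly_less degree_N)

lemma mod_N_sum: "(\<Sum>i\<in>S. g i) mod N = (\<Sum>i\<in>S. g i mod N)"
  by (induction S rule: infinite_finite_induct) (auto simp: poly_mod_add_left)

lemma coeff_mod_N_ge: "k \<ge> n \<Longrightarrow> coeff (u mod N) k = 0"
  using mod_N_degree[of u] by (intro coeff_eq_0) linarith

lemma X_power_mod_N: "k < n \<Longrightarrow> X ^ k mod N = X ^ k"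
  by (intro mod_N_eq) (simp add: degree_power_eq)

lemma coeff_X_power: "coeff (X ^ k) i = (if i = k then 1 else 0)"
  by (metis coeff_monom monom_altdef smult_1_left)

lemma theta_power_eq: "k < n \<Longrightarrow> theta_power n f k = X ^ k"
  by (simp add: theta_power_def X_power_mod_N)

lemma zeta_eq: "m < n \<Longrightarrow> zeta n f m = (\<Sum>j<m. smult (to_fract (f j)) (X ^ (m - j)))"
  by (simp add: zeta_def theta_power_eq)

lemma coeff_zeta:
  assumes "m < n"
  shows "coeff (zeta n f m) i = (if 1 \<le> i \<and> i \<le> m then to_fract (f (m - i)) else 0)"
proof -
  have "coeff (zeta n f m) i = (\<Sum>j<m. if i = m - j then to_fract (f j) else 0)"
    using assms by (simp add: zeta_eq coeff_sum coeff_X_power if_distrib cong: if_cong)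
  also have "\<dots> = (\<Sum>j<m. if j = m - i then (if 1 \<le> i \<and> i \<le> m then to_fract (f (m - i)) else 0) else 0)"
    by (intro sum.cong) auto
  finally show ?thesis by auto
qed

text \<open>Multiplication by \<theta> shifts the coordinates up; the resulting x^n term is removed
  by subtracting the multiple of F(x,1) with the same leading coefficient.\<close>

lemma coeff_X_mult_mod:
  assumes "k < n"
  shows "coeff (X * u mod N) k
    = (if k = 0 then 0 else coeff (u mod N) (k - 1))
      - coeff (u mod N) (n - 1) / F0 * to_fract (f (n - k))"
proof -
  define v where "v = u mod N"
  define w where "w = X * v - smult (coeff v (n - 1) / F0) N"
  have cw: "coeff w i = (if i = 0 then 0 else coeff v (i - 1))
      - coeff v (n - 1) / F0 * (if i \<le> n then to_fract (f (n - i)) else 0)" for i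
    by (simp add: w_def coeff_F1 coeff_pCons split: nat.split)
  have "coeff w i = 0" if "i > n - 1" for i
    using that n_pos coeff_mod_N_ge[of "i - 1" u] unfolding cw
    by (cases "i = n") (auto simp: v_def)
  then have "degree w < n"
    using n_pos degree_le[of "n - 1" w] by auto
  then have "w = w mod N" by (simp add: mod_N_eq)
  also have "\<dots> = X * v mod N"
    by (simp add: w_def mod_diff_eq[symmetric] mod_smult_left poly_mod_diff_left)
  also have "\<dots> = X * u mod N" unfolding v_def by (rule mod_mult_right_eq)
  finally show ?thesis using cw[of k] assms by (simp add: v_def)
qed

lemma mod_N_expand: "u mod N = (\<Sum>i<n. smult (coeff (u mod N) i) (X ^ i))"
proof (rule poly_eqI)
  fix k
  have "coeff (\<Sum>i<n. smult (coeff (u mod N) i) (X ^ i)) k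
      = (\<Sum>i<n. if i = k then coeff (u mod N) k else 0)"
    unfolding coeff_sum by (intro sum.cong) (auto simp: coeff_X_power)
  then show "coeff (u mod N) k = coeff (\<Sum>i<n. smult (coeff (u mod N) i) (X ^ i)) k"
    by (simp add: coeff_mod_N_ge)
qed

text \<open>A K-linear functional on the quotient is determined by its values on 1, x, ..., x^(n-1).
  It is applied to single coefficients of a remainder and to \<open>phi\<close> after a
  multiplication.\<close>

lemma functional_expand:
  fixes L :: "'a fract poly \<Rightarrow> 'a fract"
  assumes add: "\<And>u v. L (u + v) = L u + L v" and smult: "\<And>c u. L (smult c u) = c * L u"
    and modN: "\<And>u. L (u mod N) = L u"
  shows "L u = (\<Sum>i<n. coeff (u mod N) i * L (X ^ i))"
proof -
  have L0: "L 0 = 0" using smult[of 0 0] by simp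
  have "L (\<Sum>i\<in>S. g i) = (\<Sum>i\<in>S. L (g i))" if "finite S" for S and g :: "nat \<Rightarrow> _"
    using that by (induction S rule: finite_induct) (auto simp: add L0)
  then have "L (\<Sum>i<n. smult (coeff (u mod N) i) (X ^ i)) = (\<Sum>i<n. coeff (u mod N) i * L (X ^ i))"
    by (simp add: smult)
  then show ?thesis by (metis mod_N_expand modN)
qed

text \<open>The \<open>K\<close>-linear extension of \<open>\<pi>\<^bsub>n-1\<^esub>\<close> from \<open>I\<^sub>F^(n-2)\<close> to \<open>K\<^sub>F\<close>.\<close>

definition phi :: "'a fract poly \<Rightarrow> 'a fract" where
  "phi u = (- 1) ^ (n + 1) * coeff (u mod N) (n - 1) / F0"

lemma phi_add: "phi (u + v) = phi u + phi v"
  by (simp add: phi_def poly_mod_add_left distrib_left add_divide_distrib del: power_Suc)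

lemma phi_smult: "phi (smult c u) = c * phi u"
  by (simp add: phi_def mod_smult_left)

lemma phi_mod [simp]: "phi (u mod N) = phi u"
  by (simp add: phi_def)

section \<open>Matrices with respect to the power basis 1, \<theta>, ..., \<theta>^(n-1)\<close>

definition mult_mat :: "'a fract poly \<Rightarrow> 'a fract mat" where
  "mult_mat s = mat n n (\<lambda>(i, j). coeff (s * X ^ j mod N) i)"

text \<open>Coordinates stand in columns and are those of the remainders, so arbitrary
  representatives are allowed in \<open>b\<close>. Multiplication by an element acts on this matrix
  from the left, a linear recombination of the family from the right.\<close>

definition coord_mat :: "'a fract poly vec \<Rightarrow> 'a fract mat" where
  "coord_mat b = mat n n (\<lambda>(i, j). coeff (b $ j mod N) i)"

text \<open>This is the Gram matrix of the bilinear form sending u, w to phi(uw) in the power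
  basis.\<close>

definition hankel :: "'a fract mat" where
  "hankel = mat n n (\<lambda>(i, j). phi (X ^ (i + j)))"

definition phi_gram :: "'a fract poly \<Rightarrow> 'a fract poly vec \<Rightarrow> 'a fract mat" where
  "phi_gram s b = mat n n (\<lambda>(i, j). phi (s * (b $ i * b $ j)))"

lemma mat_carriers [simp]:
  "mult_mat s \<in> carrier_mat n n" "coord_mat b \<in> carrier_mat n n"
  "hankel \<in> carrier_mat n n" "phi_gram s b \<in> carrier_mat n n"
  by (simp_all add: mult_mat_def coord_mat_def hankel_def phi_gram_def)

lemma coeff_mult_mod:
  assumes "i < n"
  shows "coeff (s * u mod N) i = (\<Sum>j<n. mult_mat s $$ (i, j) * coeff (u mod N) j)"
proof -
  have "coeff (s * u mod N) i = (\<Sum>j<n. coeff (u mod N) j * coeff (s * X ^ j mod N) i)"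
    by (rule functional_expand)
      (simp_all add: distrib_left poly_mod_add_left mod_smult_left mod_mult_right_eq)
  then show ?thesis using assms by (simp add: mult_mat_def mult.commute)
qed

lemma mult_mat_mult: "mult_mat (s * t) = mult_mat s * mult_mat t"
proof (rule eq_matI)
  fix i j assume "i < dim_row (mult_mat s * mult_mat t)" "j < dim_col (mult_mat s * mult_mat t)"
  then have ij: "i < n" "j < n" by (simp_all add: mult_mat_def)
  have "mult_mat (s * t) $$ (i, j) = coeff (s * (t * X ^ j) mod N) i"
    using ij by (simp add: mult_mat_def mult.assoc)
  also have "\<dots> = (mult_mat s * mult_mat t) $$ (i, j)"
    using ij by (subst coeff_mult_mod) (simp_all add: index_mult_mat_sum[of _ n n _ n] del: index_mult_mat, simp add: mult_mat_def)
  finally show "mult_mat (s * t) $$ (i, j) = (mult_mat s * mult_mat t) $$ (i, j)" .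
qed (simp_all add: mult_mat_def)

lemma mult_mat_1: "mult_mat 1 = 1\<^sub>m n"
  by (rule eq_matI) (auto simp: mult_mat_def X_power_mod_N coeff_X_power)

lemma coord_mat_mult:
  assumes "b \<in> carrier_vec n" "b' \<in> carrier_vec n" "\<And>k. k < n \<Longrightarrow> b' $ k mod N = s * b $ k mod N"
  shows "coord_mat b' = mult_mat s * coord_mat b"
proof (rule eq_matI)
  fix i j assume "i < dim_row (mult_mat s * coord_mat b)" "j < dim_col (mult_mat s * coord_mat b)"
  then have ij: "i < n" "j < n" by (simp_all add: mult_mat_def coord_mat_def)
  show "coord_mat b' $$ (i, j) = (mult_mat s * coord_mat b) $$ (i, j)"
    using ij by (simp add: index_mult_mat_sum[of _ n n _ n] assms(3) coeff_mult_mod del: index_mult_mat add: coord_mat_def)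
qed (simp_all add: mult_mat_def coord_mat_def)

lemma phi_mult: "phi (u * w) = (\<Sum>i<n. \<Sum>j<n. coeff (u mod N) i * hankel $$ (i, j) * coeff (w mod N) j)"
proof -
  have expand: "phi (s * v) = (\<Sum>j<n. coeff (v mod N) j * phi (s * X ^ j))" for s v
  proof (rule functional_expand)
    show "phi (s * (v mod N)) = phi (s * v)" for v
      by (metis phi_mod mod_mult_right_eq)
  qed (simp_all add: distrib_left phi_add phi_smult)
  have "phi (u * w) = phi (w * u)" by (simp add: mult.commute)
  also have "\<dots> = (\<Sum>i<n. coeff (u mod N) i * phi (X ^ i * w))"
    by (subst expand) (simp add: mult.commute)
  also have "\<dots> = (\<Sum>i<n. \<Sum>j<n. coeff (u mod N) i * hankel $$ (i, j) * coeff (w mod N) j)"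
    by (intro sum.cong refl, subst expand) (simp add: sum_distrib_left hankel_def power_add mult_ac)
  finally show ?thesis .
qed

text \<open>In the power basis, the form sending u, w to phi(suw) has the matrix
  \<open>hankel * mult_mat s\<close>; the coordinate matrix of \<open>b\<close> transforms it by
  congruence.\<close>

lemma phi_gram_eq:
  "phi_gram s b = transpose_mat (coord_mat b) * (hankel * (mult_mat s * coord_mat b))"
proof (rule eq_matI)
  let ?P = "coord_mat b"
  let ?R = "transpose_mat ?P * (hankel * (mult_mat s * ?P))"
  fix i j assume "i < dim_row ?R" "j < dim_col ?R"
  then have ij: "i < n" "j < n" by (simp_all add: mult_mat_def coord_mat_def)
  have SP: "(mult_mat s * ?P) $$ (l, j) = coeff (s * b $ j mod N) l" if "l < n" for l
    using that ij by (simp add: index_mult_mat_sum[of _ n n _ n] coeff_mult_mod del: index_mult_mat)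
      (simp add: coord_mat_def)
  have c: "mult_mat s * ?P \<in> carrier_mat n n" "hankel * (mult_mat s * ?P) \<in> carrier_mat n n"
    "transpose_mat ?P \<in> carrier_mat n n"
    by (simp_all add: mult_carrier_mat[of _ n n])
  have "?R $$ (i, j) = (\<Sum>k<n. transpose_mat ?P $$ (i, k) * (\<Sum>l<n. hankel $$ (k, l) * coeff (s * b $ j mod N) l))"
    using ij by (simp add: index_mult_mat_sum[OF c(3) c(2)]
        index_mult_mat_sum[OF mat_carriers(3) c(1)] SP del: index_mult_mat)
  also have "\<dots> = phi (b $ i * (s * b $ j))"
    using ij by (subst phi_mult) (simp add: sum_distrib_left mult_ac coord_mat_def)
  also have "\<dots> = phi_gram s b $$ (i, j)" using ij by (simp add: phi_gram_def mult_ac)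
  finally show "phi_gram s b $$ (i, j) = ?R $$ (i, j)" ..
qed (simp_all add: phi_gram_def coord_mat_def)

lemma hankel_mult_mat: "hankel * mult_mat s = mat n n (\<lambda>(i, j). phi (s * X ^ (i + j)))"
proof (rule eq_matI)
  fix i j assume "i < dim_row (mat n n (\<lambda>(i, j). phi (s * X ^ (i + j))))"
    "j < dim_col (mat n n (\<lambda>(i, j). phi (s * X ^ (i + j))))"
  then have ij: "i < n" "j < n" by simp_all
  have "(hankel * mult_mat s) $$ (i, j) = (\<Sum>l<n. hankel $$ (i, l) * coeff (s * X ^ j mod N) l)"
    using ij by (simp add: index_mult_mat_sum[of _ n n _ n] del: index_mult_mat) (simp add: mult_mat_def)
  also have "\<dots> = phi (X ^ i * (s * X ^ j))"
    using ij by (subst phi_mult, subst sum.swap)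
      (simp add: X_power_mod_N coeff_X_power if_distrib[of "\<lambda>x. x * _"] cong: if_cong)
  finally show "(hankel * mult_mat s) $$ (i, j) = mat n n (\<lambda>(i, j). phi (s * X ^ (i + j))) $$ (i, j)"
    using ij by (simp add: power_add mult_ac)
qed (simp_all add: hankel_def mult_mat_def)

text \<open>The entry at (i, j) depends only on i + j. In other words, multiplication by
  \<open>s\<close> is self-adjoint for the form given by \<open>phi\<close>.\<close>

lemma hankel_mult_mat_symmetric: "transpose_mat (hankel * mult_mat s) = hankel * mult_mat s"
  unfolding hankel_mult_mat by (rule eq_matI) (auto simp: add.commute)

text \<open>The functional \<open>phi\<close> vanishes on x^k for k < n - 1 and equals
  (-1)^(n+1)/f_0 on x^(n-1), so the matrix is anti-triangular. The n-th power of the sign is 1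
  because n(n+1) is even.\<close>

lemma det_hankel: "det hankel = (- 1) ^ (n div 2) / F0 ^ n"
proof -
  have "det hankel = (- 1) ^ (n div 2) * ((- 1) ^ (n + 1) / F0) ^ n"
  proof (rule det_anti_triangular)
    show "hankel $$ (i, j) = 0" if "i + j + 1 < n" for i j
      using that by (simp add: hankel_def phi_def X_power_mod_N coeff_X_power)
    show "hankel $$ (i, j) = (- 1) ^ (n + 1) / F0" if "i + j + 1 = n" for i j
    proof -
      from that have "i < n" "j < n" "n - 1 = i + j" by auto
      then show ?thesis by (simp add: hankel_def phi_def X_power_mod_N coeff_X_power)
    qed
  qed simp
  moreover have "((- 1 :: 'a fract) ^ (n + 1)) ^ n = 1"
    by (cases "even n") auto
  ultimately show ?thesis by (simp only: power_divide times_divide_eq_right mult_1_right)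
qed

lemma det_hankel_nz: "det hankel \<noteq> 0"
  by (simp add: det_hankel)

text \<open>A matrix commuting with the companion matrix is determined by its first column, so it is
  multiplication by the element with these coordinates.\<close>

lemma commuting_is_mult_mat:
  assumes Y: "Y \<in> carrier_mat n n" and comm: "Y * mult_mat X = mult_mat X * Y"
  obtains \<gamma> where "degree \<gamma> < n" "Y = mult_mat \<gamma>"
proof -
  define g where "g = (\<Sum>i<n. smult (Y $$ (i, 0)) (X ^ i))"
  define \<gamma> where "\<gamma> = g mod N"
  have cg: "coeff g k = (if k < n then Y $$ (k, 0) else 0)" for k
  proof -
    have "coeff g k = (\<Sum>i<n. if i = k then Y $$ (k, 0) else 0)"
      unfolding g_def coeff_sum by (intro sum.cong) (auto simp: coeff_X_power)
    then show ?thesis by simp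
  qed
  then have "degree g \<le> n - 1" by (intro degree_le) auto
  then have "degree g < n" using n_pos by linarith
  then have \<gamma>g: "\<gamma> = g" by (simp add: \<gamma>_def mod_N_eq)
  have "\<forall>i<n. Y $$ (i, j) = coeff (\<gamma> * X ^ j mod N) i" if "j < n" for j
    using that
  proof (induction j)
    case 0
    then show ?case using cg by (simp add: \<gamma>g mod_N_eq \<open>degree g < n\<close>)
  next
    case (Suc j)
    show ?case
    proof (intro allI impI)
      fix i assume i: "i < n"
      \<comment> \<open>As \<open>Suc j < n\<close>, column \<open>j\<close> of
        \<open>mult_mat X\<close> is the unit vector with index \<open>Suc j\<close>, so this
        product picks out the next column of \<open>Y\<close>.\<close>
      have "(Y * mult_mat X) $$ (i, j) = (\<Sum>k<n. Y $$ (i, k) * coeff (X ^ Suc j mod N) k)"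
        using Y i Suc.prems by (simp add: index_mult_mat_sum[of _ n n _ n] del: index_mult_mat)
          (simp add: mult_mat_def)
      also have "\<dots> = Y $$ (i, Suc j)"
        using Suc.prems by (simp add: X_power_mod_N coeff_X_power if_distrib[of "\<lambda>x. _ * x"] del: power_Suc cong: if_cong)
      finally have "Y $$ (i, Suc j) = (mult_mat X * Y) $$ (i, j)" using comm by simp
      also have "\<dots> = (\<Sum>k<n. mult_mat X $$ (i, k) * coeff (\<gamma> * X ^ j mod N) k)"
        using Y i Suc by (simp add: index_mult_mat_sum[of _ n n _ n] del: index_mult_mat)
      also have "\<dots> = coeff (X * (\<gamma> * X ^ j) mod N) i"
        using i by (rule coeff_mult_mod[symmetric])
      finally show "Y $$ (i, Suc j) = coeff (\<gamma> * X ^ Suc j mod N) i"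
        by (simp only: power_Suc mult_ac)
    qed
  qed
  then have "Y = mult_mat \<gamma>" using Y by (intro eq_matI) (auto simp: mult_mat_def)
  then show ?thesis using that mod_N_degree \<gamma>_def by blast
qed

text \<open>If \<open>T\<close> describes multiplication by \<theta> on the family \<open>b\<close>,
  then its powers describe multiplication by powers of \<theta>, and by linearity p_k(T) describes
  multiplication by \<zeta>_k = p_k(\<theta>).\<close>

lemma coord_mat_p_mat:
  assumes T: "T \<in> carrier_mat n n" and comm: "mult_mat X * coord_mat b = coord_mat b * T"
    and k: "k < n"
  shows "coord_mat b * p_mat n f k T = mult_mat (zeta n f k) * coord_mat b"
proof -
  let ?P = "coord_mat b"
  have pw: "?P * (T ^\<^sub>m m) = mult_mat (X ^ m) * ?P" for m
  proof (induction m)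
    case 0
    then show ?case using T by (simp add: mult_mat_1 right_mult_one_mat[of _ n n] left_mult_one_mat[of _ n n])
  next
    case (Suc m)
    have "?P * (T ^\<^sub>m Suc m) = (?P * (T ^\<^sub>m m)) * T"
      using T by (simp add: assoc_mult_mat[of _ n n _ n _ n] pow_carrier_mat)
    also have "\<dots> = mult_mat (X ^ m) * (mult_mat X * ?P)"
      using T by (simp add: Suc.IH comm assoc_mult_mat[of _ n n _ n _ n])
    also have "\<dots> = mult_mat (X ^ m * X) * ?P"
      by (simp only: mult_mat_mult) (simp add: assoc_mult_mat[of _ n n _ n _ n])
    finally show ?case by (simp only: power_Suc2)
  qed
  have Tk: "T ^\<^sub>m m \<in> carrier_mat n n" for m using T by (simp add: pow_carrier_mat)
  have p: "p_mat n f k T \<in> carrier_mat n n" by (simp add: p_mat_def)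
  have mm: "mult_mat (zeta n f k) $$ (i, l) = (\<Sum>q<k. to_fract (f q) * mult_mat (X ^ (k - q)) $$ (i, l))"
    if "i < n" "l < n" for i l
    using that k
    by (simp add: mult_mat_def zeta_eq sum_distrib_right mod_N_sum coeff_sum mod_smult_left)
  show ?thesis
  proof (rule eq_matI)
    fix i j assume "i < dim_row (mult_mat (zeta n f k) * ?P)" "j < dim_col (mult_mat (zeta n f k) * ?P)"
    then have ij: "i < n" "j < n" by (simp_all add: mult_mat_def coord_mat_def)
    have "(?P * p_mat n f k T) $$ (i, j)
        = (\<Sum>l<n. ?P $$ (i, l) * (\<Sum>q<k. to_fract (f q) * (T ^\<^sub>m (k - q)) $$ (l, j)))"
      using ij p by (simp add: index_mult_mat_sum[of _ n n _ n] del: index_mult_mat) (simp add: p_mat_def)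
    also have "\<dots> = (\<Sum>q<k. to_fract (f q) * (\<Sum>l<n. ?P $$ (i, l) * (T ^\<^sub>m (k - q)) $$ (l, j)))"
      by (simp add: sum_distrib_left mult_ac) (rule sum.swap)
    also have "\<dots> = (\<Sum>q<k. to_fract (f q) * (?P * (T ^\<^sub>m (k - q))) $$ (i, j))"
      using ij Tk by (simp add: index_mult_mat_sum[of _ n n _ n] del: index_mult_mat)
    also have "\<dots> = (\<Sum>q<k. to_fract (f q) * (\<Sum>l<n. mult_mat (X ^ (k - q)) $$ (i, l) * ?P $$ (l, j)))"
      using ij by (simp add: pw index_mult_mat_sum[of _ n n _ n] del: index_mult_mat)
    also have "\<dots> = (\<Sum>l<n. mult_mat (zeta n f k) $$ (i, l) * ?P $$ (l, j))"
      using ij by (simp add: mm sum_distrib_left sum_distrib_right mult_ac) (rule sum.swap)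
    also have "\<dots> = (mult_mat (zeta n f k) * ?P) $$ (i, j)"
      using ij by (simp add: index_mult_mat_sum[of _ n n _ n] del: index_mult_mat)
    finally show "(?P * p_mat n f k T) $$ (i, j) = (mult_mat (zeta n f k) * ?P) $$ (i, j)" .
  qed (simp_all add: p_mat_def mult_mat_def coord_mat_def)
qed

end

subsection \<open>The lattice \<open>I\<^sub>F^(n-2)\<close> and norms\<close>

abbreviation integral :: "'a::idom fract \<Rightarrow> bool" where
  "integral a \<equiv> a \<in> range to_fract"

lemma to_fract_neg_one_power: "to_fract ((- 1) ^ k * a) = (- 1) ^ k * to_fract a"
  by (cases "even k") auto

lemma integral_neg_one_power: "integral a \<Longrightarrow> integral ((- 1) ^ k * a)"
  by (metis (no_types, lifting) imageE rangeI to_fract_neg_one_power)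

interpretation to_fract_hom: inj_idom_hom to_fract
  by unfold_locales auto

lemma R_span_iff:
  "u \<in> R_span b \<longleftrightarrow> (\<exists>c. u = (\<Sum>k<dim_vec b. smult (to_fract (c k)) (b $ k)))"
proof
  assume "\<exists>c. u = (\<Sum>k<dim_vec b. smult (to_fract (c k)) (b $ k))"
  then obtain c where "u = (\<Sum>k<dim_vec b. smult (to_fract (c k)) (b $ k))" ..
  then have "u = R_combination (vec (dim_vec b) c) b" by (simp add: R_combination_def)
  then show "u \<in> R_span b" unfolding R_span_def by (auto intro!: exI)
qed (auto simp: R_span_def R_combination_def)

lemma R_span_add:
  assumes "u \<in> R_span b" "v \<in> R_span b"
  shows "u + v \<in> R_span b"
proof -
  from assms obtain c d where "u = (\<Sum>k<dim_vec b. smult (to_fract (c k)) (b $ k))"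
    "v = (\<Sum>k<dim_vec b. smult (to_fract (d k)) (b $ k))"
    unfolding R_span_iff by blast
  then have "u + v = (\<Sum>k<dim_vec b. smult (to_fract (c k + d k)) (b $ k))"
    by (simp add: smult_add_left sum.distrib)
  then show ?thesis unfolding R_span_iff by (intro exI)
qed

lemma R_span_smult:
  assumes "u \<in> R_span b"
  shows "smult (to_fract a) u \<in> R_span b"
proof -
  from assms obtain c where "u = (\<Sum>k<dim_vec b. smult (to_fract (c k)) (b $ k))"
    unfolding R_span_iff by blast
  then have "smult (to_fract a) u = (\<Sum>k<dim_vec b. smult (to_fract (a * c k)) (b $ k))"
    by (simp add: smult_sum2)
  then show ?thesis unfolding R_span_iff by (intro exI)
qed

lemma R_span_0: "0 \<in> R_span b"
  unfolding R_span_iff by (rule exI[of _ "\<lambda>_. 0"]) simp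

lemma R_span_sum: "(\<And>i. i \<in> S \<Longrightarrow> g i \<in> R_span b) \<Longrightarrow> (\<Sum>i\<in>S. g i) \<in> R_span b"
  by (induction S rule: infinite_finite_induct) (auto intro: R_span_add R_span_0)

lemma R_span_basis:
  assumes "k < dim_vec b"
  shows "b $ k \<in> R_span b"
  unfolding R_span_iff
proof (rule exI[of _ "\<lambda>l. if l = k then 1 else 0"])
  have "(\<Sum>l<dim_vec b. smult (to_fract (if l = k then 1 else 0)) (b $ l))
      = (\<Sum>l<dim_vec b. if l = k then b $ l else 0)"
    by (intro sum.cong) auto
  then show "b $ k = (\<Sum>l<dim_vec b. smult (to_fract (if l = k then 1 else 0)) (b $ l))"
    using assms by simp
qed

lemma invertible_matE:
  fixes M :: "'b::field mat"
  assumes "M \<in> carrier_mat k k" "det M \<noteq> 0"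
  obtains M' where "M' \<in> carrier_mat k k" "M * M' = 1\<^sub>m k" "M' * M = 1\<^sub>m k"
proof -
  from det_non_zero_imp_unit[OF assms, of undefined] show ?thesis
    using that by (auto simp: Units_def ring_mat_def)
qed

context form_algebra
begin

lemma dim_IF_basis [simp]: "dim_vec (IF_basis n f) = n"
  by (simp add: IF_basis_def)

text \<open>The last basis vector contributes f_(n-1-i) to the coefficient of x^i. Since p_(n-1) has
  no constant term, it contributes nothing for i = 0, except for n = 1, where the basis vector is
  the constant f_0.\<close>

lemma coeff_IF_combination:
  assumes "i < n"
  shows "coeff (R_combination c (IF_basis n f)) i
    = (if i + 1 < n then to_fract (c $ i) else 0)
      + to_fract (c $ (n - 1)) * (if i \<ge> 1 \<or> n = 1 then to_fract (f (n - 1 - i)) else 0)"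
proof -
  obtain m where m: "n = Suc m" using n_pos by (cases n) auto
  have last: "coeff (IF_basis n f $ m) i = (if i \<ge> 1 \<or> n = 1 then to_fract (f (n - 1 - i)) else 0)"
    using assms m coeff_zeta[of m i] by (auto simp: IF_basis_def)
  have init: "IF_basis n f $ k = X ^ k" if "k < m" for k
    using that m theta_power_eq[of k] by (simp add: IF_basis_def)
  have "coeff (R_combination c (IF_basis n f)) i
      = (\<Sum>k<m. to_fract (c $ k) * coeff (IF_basis n f $ k) i)
        + to_fract (c $ m) * coeff (IF_basis n f $ m) i"
    by (simp add: R_combination_def coeff_sum) (simp add: m)
  also have "(\<Sum>k<m. to_fract (c $ k) * coeff (IF_basis n f $ k) i)
      = (\<Sum>k<m. if k = i then to_fract (c $ i) else 0)"
    by (intro sum.cong) (auto simp: init coeff_X_power)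
  also have "\<dots> = (if i + 1 < n then to_fract (c $ i) else 0)" using m by simp
  finally show ?thesis unfolding last using m by simp
qed

lemma coeff_IF_combination_last:
  "coeff (R_combination c (IF_basis n f)) (n - 1) = to_fract (c $ (n - 1)) * F0"
  using coeff_IF_combination[of "n - 1" c] n_pos by auto

lemma degree_IF_combination: "degree (R_combination c (IF_basis n f)) < n"
proof -
  have "degree (smult (to_fract (c $ k)) (IF_basis n f $ k)) \<le> n - 1" if "k < n" for k
  proof -
    have "degree (zeta n f (n - 1)) \<le> n - 1"
      using n_pos by (intro degree_le) (auto simp: coeff_zeta)
    moreover have "degree (X ^ k) \<le> n - 1" using that by (simp add: degree_power_eq)
    ultimately have "degree (IF_basis n f $ k) \<le> n - 1"
      using that n_pos by (auto simp: IF_basis_def theta_power_eq)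
    then show ?thesis using degree_smult_le le_trans by blast
  qed
  then have "degree (R_combination c (IF_basis n f)) \<le> n - 1"
    unfolding R_combination_def by (intro degree_sum_le) auto
  then show ?thesis using n_pos by linarith
qed

lemma IF_degree: "\<delta> \<in> IF n f \<Longrightarrow> degree \<delta> < n"
  using degree_IF_combination by (auto simp: IF_def R_span_def)

text \<open>The coefficient of x^(n-1) is f_0 times the last coordinate; once that is known, each
  other coefficient determines its own coordinate.\<close>

lemma IF_coords_combination:
  assumes "c \<in> carrier_vec n"
  shows "IF_coords n f (R_combination c (IF_basis n f)) = c"
  unfolding IF_coords_def
proof (rule the_equality)
  fix d assume d: "d \<in> carrier_vec n \<and> R_combination d (IF_basis n f) = R_combination c (IF_basis n f)"
  then have eq: "coeff (R_combination d (IF_basis n f)) i = coeff (R_combination c (IF_basis n f)) i" for i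
    by simp
  have last: "d $ (n - 1) = c $ (n - 1)"
    using eq[of "n - 1"] unfolding coeff_IF_combination_last by simp
  have "d $ i = c $ i" if "i < n" for i
  proof (cases "i + 1 < n")
    case True
    then show ?thesis using eq[of i] that last by (simp add: coeff_IF_combination)
  next
    case False
    then have "i = n - 1" using that by simp
    then show ?thesis using last by simp
  qed
  with d assms show "d = c" by (intro eq_vecI) auto
qed (use assms in simp)

lemma phi_pi_last:
  assumes "\<delta> \<in> IF n f"
  shows "to_fract (pi_last n f \<delta>) = phi \<delta>"
proof -
  obtain c where c: "c \<in> carrier_vec n" "\<delta> = R_combination c (IF_basis n f)"
    using assms by (auto simp: IF_def R_span_def)
  have "coeff \<delta> (n - 1) = to_fract (c $ (n - 1)) * F0"
    unfolding c(2) by (rule coeff_IF_combination_last)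
  then show ?thesis
    using mod_N_eq[OF IF_degree[OF assms]] IF_coords_combination[OF c(1)]
    by (simp add: pi_last_def phi_def c(2) to_fract_neg_one_power del: to_fract_mult)
qed

text \<open>The coefficient of x^(n-1) in \<theta>\<delta> is the coefficient of x^(n-2) in \<delta>
  minus f_1 times the last coordinate. For n \<ge> 3 the vector \<zeta>_(n-1) contributes exactly
  this f_1 term to the coefficient of x^(n-2), and the two cancel; for n \<le> 2 the term survives
  and is the correction in \<open>pi_prev\<close>.\<close>

lemma phi_pi_prev:
  assumes "\<delta> \<in> IF n f"
  shows "to_fract (pi_prev n f \<delta>) = phi (smult (- F0) (X * \<delta>))"
proof -
  obtain c where c: "c \<in> carrier_vec n" "\<delta> = R_combination c (IF_basis n f)"
    using assms by (auto simp: IF_def R_span_def)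
  have \<delta>: "\<delta> mod N = \<delta>" using mod_N_eq[OF IF_degree[OF assms]] .
  have last: "coeff \<delta> (n - 1) = to_fract (c $ (n - 1)) * F0"
    unfolding c(2) by (rule coeff_IF_combination_last)
  have "phi (smult (- F0) (X * \<delta>)) = (- 1) ^ n * coeff (X * \<delta> mod N) (n - 1)"
    unfolding phi_smult by (simp add: phi_def)
  also have "coeff (X * \<delta> mod N) (n - 1)
      = (if n = 1 then 0 else coeff \<delta> (n - 2)) - to_fract (c $ (n - 1)) * to_fract (f 1)"
  proof -
    have "coeff \<delta> (n - 1) / F0 = to_fract (c $ (n - 1))" unfolding last by simp
    then show ?thesis
      using n_pos coeff_X_mult_mod[of "n - 1" \<delta>] unfolding \<delta> by (auto simp: numeral_2_eq_2)
  qed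
  also have "\<dots> = to_fract ((if n \<ge> 2 then c $ (n - 2) else 0)
      - (if n \<le> 2 then f 1 * c $ (n - 1) else 0))"
  proof -
    consider "n = 1" | "n = 2" | "n \<ge> 3" using n_pos by linarith
    then show ?thesis
    proof cases
      case 3
      then have "n - Suc (n - 2) = 1" "n - 2 \<ge> 1" "Suc (n - 2) < n" by auto
      then show ?thesis using 3 by (simp add: c(2) coeff_IF_combination)
    next
      case 2
      then show ?thesis using coeff_IF_combination[of 0 c] by (simp add: c(2))
    qed auto
  qed
  finally show ?thesis
    unfolding pi_prev_def c(2) IF_coords_combination[OF c(1)] to_fract_neg_one_power ..
qed

text \<open>For the form taking the coefficient of x^(n-1) of a product, divided by f_0, the
  elements \<zeta>_m + f_m are dual to \<theta>^(n-1-m). The proof uses the Horner recursion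
  \<zeta>_(m+1) = \<theta>(\<zeta>_m + f_m).\<close>

lemma coeff_zeta_dual:
  assumes "m < n"
  shows "coeff (u * zeta n f m mod N) (n - 1) / F0 + to_fract (f m) * (coeff (u mod N) (n - 1) / F0)
    = coeff (u mod N) (n - 1 - m)"
  using assms
proof (induction m arbitrary: u)
  case 0
  then show ?case by (simp add: zeta_def)
next
  case (Suc m)
  have "zeta n f (Suc m) = X * zeta n f m + smult (to_fract (f m)) X"
  proof -
    have "(\<Sum>j<m. smult (to_fract (f j)) (X ^ (Suc m - j))) = X * (\<Sum>j<m. smult (to_fract (f j)) (X ^ (m - j)))"
      unfolding sum_distrib_left
      by (intro sum.cong refl) (simp add: Suc_diff_le less_imp_le del: mult_pCons_left)
    then show ?thesis using Suc.prems by (simp add: zeta_eq del: mult_pCons_left)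
  qed
  then have "u * zeta n f (Suc m) = (X * u) * zeta n f m + smult (to_fract (f m)) (X * u)"
    by (simp only: distrib_left mult_ac mult_smult_right)
  then have "coeff (u * zeta n f (Suc m) mod N) (n - 1) / F0
      = coeff ((X * u) * zeta n f m mod N) (n - 1) / F0
        + to_fract (f m) * (coeff (X * u mod N) (n - 1) / F0)"
    by (simp add: poly_mod_add_left mod_smult_left add_divide_distrib del: mult_pCons_left)
  also have "\<dots> = coeff (X * u mod N) (n - 1 - m)"
    using Suc.prems by (intro Suc.IH) simp
  also have "\<dots> = coeff (u mod N) (n - 1 - Suc m) - coeff (u mod N) (n - 1) / F0 * to_fract (f (Suc m))"
    using Suc.prems by (subst coeff_X_mult_mod) (auto simp del: mult_pCons_left)
  finally show ?case by simp
qed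

text \<open>By \<open>coeff_zeta_dual\<close> the coefficients of \<delta>, and hence its
  coordinates in the basis of I_F^(n-2), are integral combinations of the given values of
  \<open>phi\<close>, up to sign.\<close>

lemma IF_memI:
  assumes deg: "degree \<delta> < n" and "integral (phi \<delta>)"
    and "\<And>m. 1 \<le> m \<Longrightarrow> m < n \<Longrightarrow> integral (phi (\<delta> * zeta n f m))"
  shows "\<delta> \<in> IF n f"
proof -
  have phi_lead: "coeff (u mod N) (n - 1) / F0 = (- 1) ^ (n + 1) * phi u" for u
    by (cases "even n") (auto simp: phi_def)
  have "integral (coeff (\<delta> mod N) (n - 1) / F0)"
    unfolding phi_lead using assms(2) by (rule integral_neg_one_power)
  then obtain t where t: "coeff \<delta> (n - 1) / F0 = to_fract t" by (auto simp: mod_N_eq[OF deg])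
  have "\<exists>z. coeff (\<delta> * zeta n f m mod N) (n - 1) / F0 = to_fract z" if "1 \<le> m" "m < n" for m
    using integral_neg_one_power[OF assms(3)[OF that]] unfolding phi_lead by (rule imageE) (intro exI)
  then obtain z where z: "\<And>m. 1 \<le> m \<Longrightarrow> m < n \<Longrightarrow> coeff (\<delta> * zeta n f m mod N) (n - 1) / F0 = to_fract (z m)"
    by metis
  have dual: "coeff \<delta> (n - 1 - m) = to_fract (z m) + to_fract (f m) * to_fract t" if "1 \<le> m" "m < n" for m
    using coeff_zeta_dual[OF that(2), of \<delta>] unfolding z[OF that] mod_N_eq[OF deg] t by simp
  \<comment> \<open>The coefficient of x^k is z_(n-1-k) + f_(n-1-k) t, and for k \<ge> 1 its second
    summand is already supplied by t \<zeta>_(n-1). Only for k = 0 must it be kept, because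
    \<zeta>_(n-1) has no constant term.\<close>
  define c where "c = vec n (\<lambda>k. if k + 1 < n
      then (if k = 0 then z (n - 1) + f (n - 1) * t else z (n - 1 - k)) else t)"
  have "\<delta> = R_combination c (IF_basis n f)"
  proof (rule poly_eqI)
    fix i
    show "coeff \<delta> i = coeff (R_combination c (IF_basis n f)) i"
    proof (cases "i < n")
      case False
      then show ?thesis using deg degree_IF_combination[of c] by (simp add: coeff_eq_0)
    next
      case True
      have cl: "c $ (n - 1) = t" using n_pos by (simp add: c_def)
      show ?thesis
      proof (cases "i + 1 < n")
        case True
        then have "coeff \<delta> i = to_fract (z (n - 1 - i)) + to_fract (f (n - 1 - i)) * to_fract t"
          using dual[of "n - 1 - i"] by simp
        then show ?thesis
          using True cl by (auto simp: coeff_IF_combination c_def algebra_simps)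
      next
        case False
        then have i: "i = n - 1" using \<open>i < n\<close> by simp
        have "coeff \<delta> (n - 1) = to_fract t * F0" using t by (simp add: field_simps)
        then show ?thesis using cl unfolding i coeff_IF_combination_last by simp
      qed
    qed
  qed
  moreover have "c \<in> carrier_vec n" by (simp add: c_def)
  ultimately show ?thesis by (auto simp: IF_def R_span_def)
qed

section \<open>Coordinate determinants and norms\<close>

lemma coord_mat_combination_iff:
  assumes M: "M \<in> carrier_mat n n"
  shows "coord_mat b' = coord_mat b * M \<longleftrightarrow>
    (\<forall>k<n. b' $ k mod N = (\<Sum>j<n. smult (M $$ (j, k)) (b $ j)) mod N)"
proof -
  have ent: "(coord_mat b * M) $$ (i, k) = coeff ((\<Sum>j<n. smult (M $$ (j, k)) (b $ j)) mod N) i"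
    if "i < n" "k < n" for i k
    using that M
    by (simp add: index_mult_mat_sum[of _ n n _ n] del: index_mult_mat)
      (simp add: mod_N_sum coeff_sum mod_smult_left coord_mat_def mult.commute)
  show ?thesis
  proof
    assume eq: "coord_mat b' = coord_mat b * M"
    show "\<forall>k<n. b' $ k mod N = (\<Sum>j<n. smult (M $$ (j, k)) (b $ j)) mod N"
    proof (intro allI impI poly_eqI)
      fix k i assume k: "k < n"
      show "coeff (b' $ k mod N) i = coeff ((\<Sum>j<n. smult (M $$ (j, k)) (b $ j)) mod N) i"
      proof (cases "i < n")
        case True
        then have "coeff (b' $ k mod N) i = coord_mat b' $$ (i, k)" using k by (simp add: coord_mat_def)
        then show ?thesis using ent[OF True k] eq by simp
      qed (simp add: coeff_mod_N_ge)
    qed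
  next
    assume eq: "\<forall>k<n. b' $ k mod N = (\<Sum>j<n. smult (M $$ (j, k)) (b $ j)) mod N"
    show "coord_mat b' = coord_mat b * M"
    proof (rule eq_matI)
      fix i k assume "i < dim_row (coord_mat b * M)" "k < dim_col (coord_mat b * M)"
      then have ik: "i < n" "k < n" using M by (simp_all add: coord_mat_def)
      then show "coord_mat b' $$ (i, k) = (coord_mat b * M) $$ (i, k)"
        unfolding ent[OF ik] using eq by (simp add: coord_mat_def)
    qed (use M in \<open>simp_all add: coord_mat_def\<close>)
  qed
qed

lemma det_coord_mat_RF_basis: "det (coord_mat (RF_basis n f)) = F0 ^ (n - 1)"
proof -
  let ?Z = "coord_mat (RF_basis n f)"
  have zeta_mod: "zeta n f k mod N = zeta n f k" if "k < n" for k
    using that by (intro mod_N_eq le_less_trans[OF degree_le[of k]]) (auto simp: coeff_zeta)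
  have one_mod: "1 mod N = 1" using n_pos by (intro mod_N_eq) simp
  have ent: "?Z $$ (i, k) = (if k = 0 then (if i = 0 then 1 else 0)
      else if 1 \<le> i \<and> i \<le> k then to_fract (f (k - i)) else 0)" if "i < n" "k < n" for i k
    using that by (auto simp: coord_mat_def RF_basis_def zeta_mod one_mod coeff_zeta)
  have "upper_triangular ?Z"
    using carrier_matD[OF mat_carriers(2)] by (intro upper_triangularI) (auto simp: ent)
  then have "det ?Z = prod_list (diag_mat ?Z)" by (rule det_upper_triangular[OF _ mat_carriers(2)])
  also have "\<dots> = (\<Prod>i = 0..<n. ?Z $$ (i, i))"
    using carrier_matD[OF mat_carriers(2)] by (simp add: prod_list_diag_prod)
  also have "\<dots> = (\<Prod>i = 0..<n. if i = 0 then 1 else F0)"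
    by (intro prod.cong) (auto simp: ent)
  also have "\<dots> = F0 ^ (n - 1)"
    using n_pos by (cases n) (simp_all add: prod.atLeast0_lessThan_Suc_shift del: prod.op_ivl_Suc)
  finally show ?thesis .
qed

text \<open>The matrix in the definition of the norm satisfies
  \<open>coord_mat b = coord_mat (RF_basis n f) * M\<close>. It exists and is unique because the
  left factor is invertible: it is triangular of determinant f_0^(n-1).\<close>

lemma ideal_norm_eq:
  assumes b: "b \<in> carrier_vec n" "\<And>k. k < n \<Longrightarrow> b $ k \<in> KF n"
  shows "ideal_norm n f b * F0 ^ (n - 1) = det (coord_mat b)"
proof -
  let ?Z = "coord_mat (RF_basis n f)"
  obtain Z' where Z': "Z' \<in> carrier_mat n n" "?Z * Z' = 1\<^sub>m n" "Z' * ?Z = 1\<^sub>m n"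
    using invertible_matE[of ?Z n] det_coord_mat_RF_basis by auto
  have degRF: "degree (RF_basis n f $ j) < n" if "j < n" for j
  proof -
    have "degree (zeta n f j) \<le> j" using that by (intro degree_le) (auto simp: coeff_zeta)
    then show ?thesis using that by (auto simp: RF_basis_def)
  qed
  have "(\<forall>k<n. b $ k = (\<Sum>j<n. smult (M $$ (j, k)) (RF_basis n f $ j))) \<longleftrightarrow> coord_mat b = ?Z * M"
    if M: "M \<in> carrier_mat n n" for M
  proof -
    have "(\<Sum>j<n. smult (M $$ (j, k)) (RF_basis n f $ j)) mod N
        = (\<Sum>j<n. smult (M $$ (j, k)) (RF_basis n f $ j))" for k
      using degRF by (simp add: mod_N_sum mod_smult_left mod_N_eq)
    then show ?thesis
      unfolding coord_mat_combination_iff[OF M] using b(2) by (simp add: mod_N_eq KF_def)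
  qed
  then have eq: "(M \<in> carrier_mat n n \<and> (\<forall>k<n. b $ k = (\<Sum>j<n. smult (M $$ (j, k)) (RF_basis n f $ j))))
      \<longleftrightarrow> M \<in> carrier_mat n n \<and> coord_mat b = ?Z * M" for M
    by blast
  have "(THE M. M \<in> carrier_mat n n \<and> coord_mat b = ?Z * M) = Z' * coord_mat b"
  proof (rule the_equality)
    have "?Z * (Z' * coord_mat b) = coord_mat b"
      unfolding assoc_mult_mat[OF mat_carriers(2) Z'(1) mat_carriers(2), symmetric] Z'(2)
      by (simp add: left_mult_one_mat[of _ n n])
    then show "Z' * coord_mat b \<in> carrier_mat n n \<and> coord_mat b = ?Z * (Z' * coord_mat b)"
      using Z' by (simp add: mult_carrier_mat[of _ n n])
  next
    fix M assume M: "M \<in> carrier_mat n n \<and> coord_mat b = ?Z * M"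
    then have "Z' * coord_mat b = Z' * ?Z * M"
      using assoc_mult_mat[OF Z'(1) mat_carriers(2), of M n] by simp
    then show "M = Z' * coord_mat b" using conjunct1[OF M] unfolding Z'(3) by (simp only: left_mult_one_mat)
  qed
  then have "ideal_norm n f b = det Z' * det (coord_mat b)"
    unfolding ideal_norm_def eq using Z'(1) by (simp add: det_mult)
  moreover have "F0 ^ (n - 1) * det Z' = 1"
    using det_mult[OF mat_carriers(2) Z'(1), of "RF_basis n f"] Z'(2) det_coord_mat_RF_basis by simp
  ultimately show ?thesis by (simp add: mult_ac)
qed

text \<open>The matrix is upper triangular and only its last diagonal entry, f_0, differs from 1.
  With \<open>ideal_norm_eq\<close> this gives N(I_F^(n-2)) = f_0^(2-n).\<close>

lemma det_coord_mat_IF_basis: "det (coord_mat (IF_basis n f)) = F0"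
proof -
  let ?Z = "coord_mat (IF_basis n f)"
  have IF_mod: "IF_basis n f $ k mod N = IF_basis n f $ k" if "k < n" for k
    using that R_span_basis[of k "IF_basis n f"] by (intro mod_N_eq IF_degree) (simp add: IF_def)
  have ent: "?Z $$ (i, k) = (if k + 1 < n then (if i = k then 1 else 0)
      else if i \<ge> 1 \<or> n = 1 then to_fract (f (n - 1 - i)) else 0)" if "i < n" "k < n" for i k
  proof (cases "k + 1 < n")
    case True
    then show ?thesis
      using that IF_mod[of k] by (simp add: coord_mat_def) (simp add: IF_basis_def theta_power_eq coeff_X_power)
  next
    case False
    then have "k = n - 1" using that by simp
    then show ?thesis
      using that IF_mod[of k] by (simp add: coord_mat_def) (auto simp: IF_basis_def coeff_zeta)
  qed
  have "upper_triangular ?Z"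
    using carrier_matD[OF mat_carriers(2)] by (intro upper_triangularI) (auto simp: ent)
  then have "det ?Z = prod_list (diag_mat ?Z)" by (rule det_upper_triangular[OF _ mat_carriers(2)])
  also have "\<dots> = (\<Prod>i = 0..<n. ?Z $$ (i, i))"
    using carrier_matD[OF mat_carriers(2)] by (simp add: prod_list_diag_prod)
  also have "\<dots> = (\<Prod>i = 0..<n. if i = n - 1 then F0 else 1)"
    by (intro prod.cong) (auto simp: ent)
  also have "\<dots> = F0"
    using n_pos by (simp add: prod.delta)
  finally show ?thesis .
qed

lemma KF_norm_eq: "KF_norm n f \<kappa> = det (mult_mat \<kappa>)"
  by (simp add: KF_norm_def mult_mat_def KF_mult_def)

end

subsection \<open>Orbits and Gram matrices\<close>

lemma Gn_carrier: "g \<in> Gn n \<Longrightarrow> g \<in> carrier_mat n n"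
  by (simp add: Gn_def)

lemma one_in_Gn: "1\<^sub>m n \<in> Gn n"
  by (simp add: Gn_def)

lemma Gn_mult:
  assumes "g \<in> Gn n" "h \<in> Gn n"
  shows "g * h \<in> Gn n"
  using assms det_mult[of g n h] by (auto simp: Gn_def split: if_splits)

text \<open>Since det(g) squares to 1, det(g) times the adjugate is an inverse over R, and it has
  the same determinant as \<open>g\<close>.\<close>

lemma Gn_inverse:
  assumes g: "g \<in> Gn n"
  obtains h where "h \<in> Gn n" "g * h = 1\<^sub>m n" "h * g = 1\<^sub>m n"
proof -
  note gc = Gn_carrier[OF g]
  have sq: "det g * det g = 1" using g by (auto simp: Gn_def split: if_splits)
  define h where "h = det g \<cdot>\<^sub>m adj_mat g"
  note adj = adj_mat[OF gc]
  have hc: "h \<in> carrier_mat n n" using adj(1) by (simp add: h_def)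
  have gh: "g * h = 1\<^sub>m n"
    unfolding h_def using gc adj sq
    by (simp add: mult_smult_distrib[OF gc adj(1)]) (intro eq_matI, auto)
  have hg: "h * g = 1\<^sub>m n"
    unfolding h_def using gc adj sq
    by (simp add: mult_smult_assoc_mat[OF adj(1) gc]) (intro eq_matI, auto)
  have "det g * det h = 1" using det_mult[OF gc hc] gh by simp
  then have "det h = det g" using sq by (metis mult.assoc mult.commute mult_1_right)
  then have "h \<in> Gn n" using g hc by (simp add: Gn_def)
  then show ?thesis using that gh hg by blast
qed

lemma Gn_orbit_self: "A \<in> carrier_mat n n \<Longrightarrow> B \<in> carrier_mat n n \<Longrightarrow> (A, B) \<in> Gn_orbit n (A, B)"
  unfolding Gn_orbit_def by (auto intro!: exI[of _ "1\<^sub>m n"] one_in_Gn)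

lemma Gn_orbit_subset:
  assumes "A \<in> carrier_mat n n" "B \<in> carrier_mat n n" "g \<in> Gn n"
  shows "Gn_orbit n (g * A * transpose_mat g, g * B * transpose_mat g) \<subseteq> Gn_orbit n (A, B)"
proof
  fix C assume "C \<in> Gn_orbit n (g * A * transpose_mat g, g * B * transpose_mat g)"
  then obtain h where h: "h \<in> Gn n"
    "C = (h * (g * A * transpose_mat g) * transpose_mat h, h * (g * B * transpose_mat g) * transpose_mat h)"
    by (auto simp: Gn_orbit_def)
  note gc = Gn_carrier[OF assms(3)] and hc = Gn_carrier[OF h(1)]
  have "h * (g * M * transpose_mat g) * transpose_mat h = (h * g) * M * transpose_mat (h * g)"
    if "M \<in> carrier_mat n n" for M
    using that gc hc
    by (simp add: assoc_mult_mat[of _ n n _ n _ n] transpose_mult[of _ n n _ n] mult_carrier_mat[of _ n n])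
  then have "C = ((h * g) * A * transpose_mat (h * g), (h * g) * B * transpose_mat (h * g))"
    using h(2) assms by simp
  then show "C \<in> Gn_orbit n (A, B)"
    using Gn_mult[OF h(1) assms(3)] by (auto simp: Gn_orbit_def)
qed

lemma Gn_orbit_eq:
  assumes AB: "A \<in> carrier_mat n n" "B \<in> carrier_mat n n" and g: "g \<in> Gn n"
  shows "Gn_orbit n (g * A * transpose_mat g, g * B * transpose_mat g) = Gn_orbit n (A, B)"
proof (rule antisym[OF Gn_orbit_subset[OF assms]])
  note gc = Gn_carrier[OF g]
  obtain h where h: "h \<in> Gn n" "h * g = 1\<^sub>m n" by (rule Gn_inverse[OF g])
  note hc = Gn_carrier[OF h(1)]
  have "h * (g * M * transpose_mat g) * transpose_mat h = M" if M: "M \<in> carrier_mat n n" for M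
  proof -
    have "h * (g * M * transpose_mat g) * transpose_mat h = (h * g) * M * transpose_mat (h * g)"
      using M gc hc
      by (simp add: assoc_mult_mat[of _ n n _ n _ n] transpose_mult[of _ n n _ n] mult_carrier_mat[of _ n n])
    then show ?thesis using M h(2) by simp
  qed
  then show "Gn_orbit n (A, B) \<subseteq> Gn_orbit n (g * A * transpose_mat g, g * B * transpose_mat g)"
    using Gn_orbit_subset[of "g * A * transpose_mat g" n "g * B * transpose_mat g" h] AB gc h(1)
    by (simp add: mult_carrier_mat[of _ n n])
qed

context form_algebra
begin

section \<open>Gram matrices of pairs in H_{F,r}\<close>

lemma one_mod_N: "1 mod N = 1"
  using n_pos by (intro mod_N_eq) simp

lemma KF_mod: "u mod N \<in> KF n"
  by (simp add: KF_def mod_N_degree)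

lemma KF_mod_eq: "u \<in> KF n \<Longrightarrow> u mod N = u"
  by (simp add: KF_def mod_N_eq)

lemma KF_inverse_eq:
  assumes v: "v \<in> KF n" "\<alpha> * v mod N = 1"
  shows "KF_inverse n f \<alpha> = v"
  unfolding KF_inverse_def KF_mult_def
proof (rule the_equality)
  fix w assume w: "w \<in> KF n \<and> \<alpha> * w mod N = 1"
  have "w mod N = (w * (\<alpha> * v mod N)) mod N" by (simp add: v)
  also have "\<dots> = (v * (\<alpha> * w)) mod N" by (simp add: mod_mult_right_eq mult_ac)
  also have "\<dots> = (v * (\<alpha> * w mod N)) mod N" by (rule mod_mult_right_eq[symmetric])
  also have "\<dots> = v mod N" using w by simp
  finally show "w = v" using w v by (simp add: KF_mod_eq)
qed (use v in simp)

lemma KF_inverse: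
  assumes "\<alpha> \<in> KF_units n f"
  shows "KF_inverse n f \<alpha> \<in> KF n" "\<alpha> * KF_inverse n f \<alpha> mod N = 1"
proof -
  obtain v where v: "v \<in> KF n" "\<alpha> * v mod N = 1"
    using assms by (auto simp: KF_units_def KF_mult_def)
  show "KF_inverse n f \<alpha> \<in> KF n" "\<alpha> * KF_inverse n f \<alpha> mod N = 1"
    using v KF_inverse_eq[OF v] by auto
qed

lemma phi_cong: "u mod N = v mod N \<Longrightarrow> phi u = phi v"
  by (metis phi_mod)

text \<open>The functionals \<open>pi_last\<close> and \<open>pi_prev\<close> are meaningful on
  I_F^(n-2) only; the inclusion of I^2 in \<alpha> I_F^(n-2), multiplied by the inverse of \<alpha>,
  places the products there.\<close>

lemma product_in_IF:
  assumes \<alpha>: "\<alpha> \<in> KF_units n f" and b: "b \<in> carrier_vec n"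
    and sub: "ideal_mult n f (R_span b) (R_span b) \<subseteq> KF_mult n f \<alpha> ` IF n f"
    and ij: "i < n" "j < n"
  shows "KF_inverse n f \<alpha> * (b $ i * b $ j) mod N \<in> IF n f"
proof -
  let ?\<gamma> = "KF_inverse n f \<alpha>"
  have "KF_mult n f (b $ i) (b $ j) \<in> ideal_mult n f (R_span b) (R_span b)"
    unfolding ideal_mult_def
    by (rule CollectI, rule exI[of _ 1], rule exI[of _ "\<lambda>_. b $ i"], rule exI[of _ "\<lambda>_. b $ j"])
      (use b ij in \<open>simp add: R_span_basis\<close>)
  with sub obtain \<iota> where \<iota>: "\<iota> \<in> IF n f" "b $ i * b $ j mod N = \<alpha> * \<iota> mod N"
    by (auto simp: KF_mult_def)
  have "?\<gamma> * (b $ i * b $ j) mod N = ?\<gamma> * (\<alpha> * \<iota>) mod N"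
    using \<iota>(2) by (metis mod_mult_right_eq)
  also have "\<dots> = (\<alpha> * ?\<gamma>) * \<iota> mod N" by (simp only: mult_ac)
  also have "\<dots> = (\<alpha> * ?\<gamma> mod N) * \<iota> mod N" by (rule mod_mult_left_eq[symmetric])
  also have "\<dots> = \<iota>" using \<iota>(1) KF_inverse(2)[OF \<alpha>] by (simp add: mod_N_eq IF_degree)
  finally show ?thesis using \<iota>(1) by simp
qed

text \<open>Over K both Gram matrices come from the single functional \<open>phi\<close>, and they
  differ only by the factor -f_0 \<theta> inside it.\<close>

lemma gram_eq_phi_gram:
  assumes \<alpha>: "\<alpha> \<in> KF_units n f" and b: "b \<in> carrier_vec n"
    and sub: "ideal_mult n f (R_span b) (R_span b) \<subseteq> KF_mult n f \<alpha> ` IF n f"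
  shows "map_mat to_fract (gram n f (pi_last n f) b \<alpha>) = phi_gram (KF_inverse n f \<alpha>) b"
    and "map_mat to_fract (gram n f (pi_prev n f) b \<alpha>)
      = phi_gram (smult (- F0) (X * KF_inverse n f \<alpha>)) b"
proof -
  let ?\<gamma> = "KF_inverse n f \<alpha>"
  have \<delta>: "KF_mult n f ?\<gamma> (KF_mult n f (b $ i) (b $ j)) = ?\<gamma> * (b $ i * b $ j) mod N" for i j
    by (simp add: KF_mult_def mod_mult_right_eq)
  show "map_mat to_fract (gram n f (pi_last n f) b \<alpha>) = phi_gram ?\<gamma> b"
    by (rule eq_matI)
      (auto simp: gram_def phi_gram_def \<delta> phi_pi_last[OF product_in_IF[OF assms]])
  have "phi (smult (- F0) (X * (?\<gamma> * u mod N))) = phi (smult (- F0) (X * ?\<gamma>) * u)" for u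
  proof (rule phi_cong)
    have "X * (?\<gamma> * u mod N) mod N = (X * ?\<gamma>) * u mod N"
      by (simp only: mod_mult_right_eq mult.assoc)
    then show "smult (- F0) (X * (?\<gamma> * u mod N)) mod N = smult (- F0) (X * ?\<gamma>) * u mod N"
      by (simp only: mod_smult_left mult_smult_left)
  qed
  then show "map_mat to_fract (gram n f (pi_prev n f) b \<alpha>) = phi_gram (smult (- F0) (X * ?\<gamma>)) b"
    by (intro eq_matI)
      (simp_all add: gram_def phi_gram_def \<delta> phi_pi_prev[OF product_in_IF[OF assms]]
        del: mult_pCons_left smult_pCons mult_smult_left)
qed

text \<open>Row \<open>i\<close> of \<open>g\<close> gives the new basis vector \<open>i\<close>,
  whereas coordinates stand in columns; hence the transpose.\<close>

lemma coord_mat_change_basis: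
  assumes "g \<in> carrier_mat n n" "b \<in> carrier_vec n"
  shows "coord_mat (change_basis g b) = coord_mat b * transpose_mat (map_mat to_fract g)"
  using assms by (subst coord_mat_combination_iff) (auto simp: change_basis_def R_combination_def)

lemma phi_gram_change_basis:
  assumes g: "g \<in> carrier_mat n n" and b: "b \<in> carrier_vec n"
  shows "phi_gram s (change_basis g b)
    = map_mat to_fract g * phi_gram s b * transpose_mat (map_mat to_fract g)"
proof -
  have G: "map_mat to_fract g \<in> carrier_mat n n" using g by simp
  show ?thesis
    unfolding phi_gram_eq coord_mat_change_basis[OF assms]
    using G by (simp add: assoc_mult_mat[of _ n n _ n _ n] transpose_mult[of _ n n _ n] mult_carrier_mat[of _ n n])
qed

lemma map_mat_to_fract_conj:
  assumes "g \<in> carrier_mat n n" "A \<in> carrier_mat n n"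
  shows "map_mat to_fract (g * A * transpose_mat g)
    = map_mat to_fract g * map_mat to_fract A * transpose_mat (map_mat to_fract g)"
  using assms by (simp add: to_fract_hom.mat_hom_mult[of _ n n _ n] mult_carrier_mat[of _ n n] map_mat_transpose)

lemma map_mat_to_fract_inj: "map_mat to_fract A = map_mat to_fract B \<Longrightarrow> A = B"
  by (rule to_fract_hom.mat_hom_inj)

lemma H_pairsD:
  assumes "(b, \<alpha>) \<in> H_pairs n f r"
  shows "based_ideal n f b" "\<alpha> \<in> KF_units n f" "b \<in> carrier_vec n" "\<And>k. k < n \<Longrightarrow> b $ k \<in> KF n"
    "ideal_mult n f (R_span b) (R_span b) \<subseteq> KF_mult n f \<alpha> ` IF n f"
  using assms by (auto simp: H_pairs_def based_ideal_def)

text \<open>Scaling the basis by \<kappa> multiplies products of basis vectors by \<kappa>^2, which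
  the inverse of \<kappa>^2 \<alpha> cancels. Only the change of basis by \<open>g\<close> remains,
  and it acts by congruence.\<close>

lemma gram_H_rel:
  assumes "((b, \<alpha>), (b', \<alpha>')) \<in> H_rel n f r"
  obtains g where "g \<in> Gn n"
    "gram n f (pi_last n f) b' \<alpha>' = g * gram n f (pi_last n f) b \<alpha> * transpose_mat g"
    "gram n f (pi_prev n f) b' \<alpha>' = g * gram n f (pi_prev n f) b \<alpha> * transpose_mat g"
proof -
  from assms obtain \<kappa> g where p: "(b, \<alpha>) \<in> H_pairs n f r" "(b', \<alpha>') \<in> H_pairs n f r"
    and \<kappa>: "\<kappa> \<in> KF_units n f" and g: "g \<in> Gn n"
    and b': "b' = change_basis g (scale_basis n f \<kappa> b)"
    and \<alpha>': "\<alpha>' = KF_mult n f (KF_mult n f \<kappa> \<kappa>) \<alpha>"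
    by (auto simp: H_rel_def)
  note P = H_pairsD[OF p(1)] and P' = H_pairsD[OF p(2)] and gc = Gn_carrier[OF g]
  let ?\<gamma> = "KF_inverse n f \<alpha>" and ?\<gamma>' = "KF_inverse n f \<alpha>'"
  have \<alpha>'_mod: "\<alpha>' mod N = \<kappa> * \<kappa> * \<alpha> mod N"
    by (simp add: \<alpha>' KF_mult_def mod_mult_left_eq)
  have inv: "?\<gamma>' * (\<kappa> * \<kappa>) mod N = ?\<gamma> mod N"
  proof -
    have "?\<gamma> mod N = ?\<gamma> * (\<alpha>' * ?\<gamma>' mod N) mod N" using KF_inverse(2)[OF P'(2)] by simp
    also have "\<dots> = \<alpha>' * (?\<gamma> * ?\<gamma>') mod N" by (simp add: mod_mult_right_eq mult_ac)
    also have "\<dots> = ((\<alpha>' mod N) * (?\<gamma> * ?\<gamma>')) mod N" by (rule mod_mult_left_eq[symmetric])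
    also have "\<dots> = (\<kappa> * \<kappa> * \<alpha>) * (?\<gamma> * ?\<gamma>') mod N"
      unfolding \<alpha>'_mod by (rule mod_mult_left_eq)
    also have "\<dots> = (\<alpha> * ?\<gamma>) * (?\<gamma>' * (\<kappa> * \<kappa>)) mod N" by (simp only: mult_ac)
    also have "\<dots> = (\<alpha> * ?\<gamma> mod N) * (?\<gamma>' * (\<kappa> * \<kappa>)) mod N" by (rule mod_mult_left_eq[symmetric])
    finally show ?thesis using KF_inverse(2)[OF P(2)] by simp
  qed
  let ?c = "scale_basis n f \<kappa> b"
  have c: "?c \<in> carrier_vec n" using P(3) by (simp add: scale_basis_def)
  have scale: "phi_gram (s * ?\<gamma>') ?c = phi_gram (s * ?\<gamma>) b" for s
  proof (rule eq_matI)
    fix i j assume "i < dim_row (phi_gram (s * ?\<gamma>) b)" "j < dim_col (phi_gram (s * ?\<gamma>) b)"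
    then have ij: "i < n" "j < n" by (simp_all add: phi_gram_def)
    have ck: "?c $ k mod N = \<kappa> * b $ k mod N" if "k < n" for k
      using that P(3) by (simp add: scale_basis_def KF_mult_def)
    have "(s * ?\<gamma>') * (?c $ i * ?c $ j) mod N = (s * ?\<gamma>') * ((\<kappa> * b $ i) * (\<kappa> * b $ j)) mod N"
      by (intro mod_mult_cong refl ck ij)
    also have "\<dots> = (?\<gamma>' * (\<kappa> * \<kappa>)) * (s * (b $ i * b $ j)) mod N" by (simp only: mult_ac)
    also have "\<dots> = ?\<gamma> * (s * (b $ i * b $ j)) mod N" by (intro mod_mult_cong refl inv)
    also have "\<dots> = (s * ?\<gamma>) * (b $ i * b $ j) mod N" by (simp only: mult_ac)
    finally have "phi ((s * ?\<gamma>') * (?c $ i * ?c $ j)) = phi ((s * ?\<gamma>) * (b $ i * b $ j))"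
      by (rule phi_cong)
    then show "phi_gram (s * ?\<gamma>') ?c $$ (i, j) = phi_gram (s * ?\<gamma>) b $$ (i, j)"
      using ij by (simp add: phi_gram_def)
  qed (simp_all add: phi_gram_def)
  have gram_c: "gram n f \<pi> b \<alpha> \<in> carrier_mat n n" for \<pi> by (simp add: gram_def)
  have "map_mat to_fract (gram n f (pi_last n f) b' \<alpha>')
      = map_mat to_fract (g * gram n f (pi_last n f) b \<alpha> * transpose_mat g)"
    using scale[of 1] unfolding map_mat_to_fract_conj[OF gc gram_c]
      gram_eq_phi_gram[OF P(2,3,5)] gram_eq_phi_gram[OF P'(2,3,5)]
    unfolding b' phi_gram_change_basis[OF gc c] by simp
  moreover have "map_mat to_fract (gram n f (pi_prev n f) b' \<alpha>')
      = map_mat to_fract (g * gram n f (pi_prev n f) b \<alpha> * transpose_mat g)"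
    using scale[of "smult (- F0) X"] unfolding map_mat_to_fract_conj[OF gc gram_c]
      gram_eq_phi_gram[OF P(2,3,5)] gram_eq_phi_gram[OF P'(2,3,5)]
    unfolding b' phi_gram_change_basis[OF gc c] mult_smult_left by (simp only:)
  ultimately show ?thesis using that[OF g] map_mat_to_fract_inj by blast
qed

text \<open>This ensures that the orbit of a pair occurs in the union by which \<open>orb\<close> is
  defined on its class.\<close>

lemma H_rel_refl:
  assumes "(b, \<alpha>) \<in> H_pairs n f r"
  shows "((b, \<alpha>), (b, \<alpha>)) \<in> H_rel n f r"
proof -
  note P = H_pairsD[OF assms]
  have one: "1 \<in> KF_units n f"
    using n_pos by (auto simp: KF_units_def KF_def KF_mult_def one_mod_N intro!: exI[of _ 1] bexI[of _ 1])
  have "scale_basis n f 1 b = b"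
    using P(3,4) by (intro eq_vecI) (auto simp: scale_basis_def KF_mult_def KF_mod_eq)
  moreover have "change_basis (1\<^sub>m n) b = b"
  proof (rule eq_vecI)
    fix i assume "i < dim_vec b"
    then have i: "i < n" using P(3) by simp
    have "(\<Sum>k<n. smult (to_fract (if k = i then 1 else 0)) (b $ k)) = (\<Sum>k<n. if k = i then b $ i else 0)"
      using i by (intro sum.cong) auto
    then show "change_basis (1\<^sub>m n) b $ i = b $ i"
      using i P(3) by (simp add: change_basis_def R_combination_def)
  qed (use P(3) in \<open>simp add: change_basis_def\<close>)
  moreover have "KF_mult n f (KF_mult n f 1 1) \<alpha> = \<alpha>"
    using P(2) by (simp add: KF_mult_def one_mod_N KF_units_def KF_mod_eq)
  ultimately show ?thesis
    using assms one one_in_Gn[of n] unfolding H_rel_def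
    by (auto intro!: bexI[of _ 1] bexI[of _ "1\<^sub>m n"])
qed

lemma orb_class:
  assumes "(b, \<alpha>) \<in> H_pairs n f r"
  shows "orb n f (H_rel n f r `` {(b, \<alpha>)})
    = Gn_orbit n (gram n f (pi_last n f) b \<alpha>, gram n f (pi_prev n f) b \<alpha>)" (is "_ = ?O")
proof -
  have "Gn_orbit n (gram n f (pi_last n f) b' \<alpha>', gram n f (pi_prev n f) b' \<alpha>') = ?O"
    if "((b, \<alpha>), (b', \<alpha>')) \<in> H_rel n f r" for b' \<alpha>'
  proof -
    from that obtain g where g: "g \<in> Gn n"
      "gram n f (pi_last n f) b' \<alpha>' = g * gram n f (pi_last n f) b \<alpha> * transpose_mat g"
      "gram n f (pi_prev n f) b' \<alpha>' = g * gram n f (pi_prev n f) b \<alpha> * transpose_mat g"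
      by (rule gram_H_rel)
    show ?thesis unfolding g(2,3) by (rule Gn_orbit_eq[OF _ _ g(1)]) (simp_all add: gram_def)
  qed
  then show ?thesis using H_rel_refl[OF assms] unfolding orb_def by blast
qed

end

subsection \<open>From Gram matrices to integrality\<close>

text \<open>The determinant identity is specialised at two constant values of z. At z = 0 it gives
  det(A); at z = 1/f_0 the form becomes F(x,1) and the pencil becomes xA + B/f_0 = A(xI -
  T).\<close>

lemma char_poly_of_pencil:
  fixes A B :: "'a::idom mat"
  assumes f0: "f 0 \<noteq> 0" and r: "r \<noteq> 0"
    and A: "A \<in> carrier_mat n n" and B: "B \<in> carrier_mat n n"
    and pencil: "(- 1) ^ (n div 2) *
           det (varX \<cdot>\<^sub>m map_mat (\<lambda>a. constXZ (to_fract a)) A +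
                varZ \<cdot>\<^sub>m map_mat (\<lambda>b. constXZ (to_fract b)) B)
         = constXZ (to_fract r) * constXZ (1 / to_fract (f 0)) *
           binary_form n (\<lambda>i. constXZ (to_fract (f i))) varX (constXZ (to_fract (f 0)) * varZ)"
  shows "(- 1) ^ (n div 2) * det (map_mat to_fract A) = to_fract r"
    and "T \<in> carrier_mat n n \<Longrightarrow>
      map_mat to_fract A * T = (- 1 / to_fract (f 0)) \<cdot>\<^sub>m map_mat to_fract B \<Longrightarrow>
      char_poly T = smult (1 / to_fract (f 0)) (F1 n f)"
proof -
  let ?A = "map_mat to_fract A" and ?B = "map_mat to_fract B"
  let ?X = "[:0, 1:] :: 'a fract poly"
  interpret c: comm_ring_hom "\<lambda>a :: 'a fract. [:a:]"
    by unfold_locales (auto simp: one_pCons)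
  have special: "(- 1) ^ (n div 2) * det (?X \<cdot>\<^sub>m map_mat (\<lambda>a. [:a:]) ?A + [:z:] \<cdot>\<^sub>m map_mat (\<lambda>a. [:a:]) ?B)
      = [:to_fract r / to_fract (f 0):] *
        (\<Sum>i\<le>n. [:to_fract (f i):] * ?X ^ (n - i) * [:to_fract (f 0) * z:] ^ i)" for z
  proof -
    let ?E = "\<lambda>p :: 'a fract poly poly. poly p [:z:]"
    let ?M = "varX \<cdot>\<^sub>m map_mat (\<lambda>a. constXZ (to_fract a)) A +
                varZ \<cdot>\<^sub>m map_mat (\<lambda>b. constXZ (to_fract b)) B"
    have E: "map_mat ?E ?M = ?X \<cdot>\<^sub>m map_mat (\<lambda>a. [:a:]) ?A + [:z:] \<cdot>\<^sub>m map_mat (\<lambda>a. [:a:]) ?B"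
      using A B by (intro eq_matI) (auto simp: varX_def varZ_def constXZ_def)
    have "comm_ring_hom ?E" by unfold_locales
    \<comment> \<open>Evaluation at a constant z is a ring homomorphism, so it commutes with the
      determinant.\<close>
    then have "det (map_mat ?E ?M) = ?E (det ?M)" by (rule comm_ring_hom.hom_det)
    then have "(- 1) ^ (n div 2) * det (map_mat ?E ?M) = ?E ((- 1) ^ (n div 2) * det ?M)"
      by simp
    also have "\<dots> = [:to_fract r / to_fract (f 0):] *
        (\<Sum>i\<le>n. [:to_fract (f i):] * ?X ^ (n - i) * [:to_fract (f 0) * z:] ^ i)"
      unfolding pencil by (simp add: binary_form_def poly_sum constXZ_def varX_def varZ_def)
    finally show ?thesis unfolding E .
  qed
  show det: "(- 1) ^ (n div 2) * det ?A = to_fract r"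
  proof -
    have "?X \<cdot>\<^sub>m map_mat (\<lambda>a. [:a:]) ?A + [:0:] \<cdot>\<^sub>m map_mat (\<lambda>a. [:a:]) ?B
        = ?X \<cdot>\<^sub>m map_mat (\<lambda>a. [:a:]) ?A"
      using A B by (intro eq_matI) auto
    then have "det (?X \<cdot>\<^sub>m map_mat (\<lambda>a. [:a:]) ?A + [:0:] \<cdot>\<^sub>m map_mat (\<lambda>a. [:a:]) ?B)
        = ?X ^ n * [:det ?A:]"
      using A by (simp add: c.hom_det)
    moreover have "(\<Sum>i\<le>n. [:to_fract (f i):] * ?X ^ (n - i) * [:to_fract (f 0) * 0:] ^ i)
        = (\<Sum>i\<le>n. if i = 0 then [:to_fract (f 0):] * ?X ^ n else 0)"
      by (intro sum.cong) (auto simp: power_0_left)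
    ultimately have "(- 1) ^ (n div 2) * (?X ^ n * [:det ?A:])
        = [:to_fract r / to_fract (f 0):] * ([:to_fract (f 0):] * ?X ^ n)"
      using special[of 0] by simp
    then have "?X ^ n * [:(- 1) ^ (n div 2) * det ?A:] = ?X ^ n * [:to_fract r:]"
      using f0 by (cases "even (n div 2)") (simp_all add: mult.commute)
    moreover have "?X ^ n \<noteq> 0" by simp
    ultimately have "[:(- 1) ^ (n div 2) * det ?A:] = [:to_fract r:]" using mult_left_cancel by blast
    then show ?thesis by (simp only: pCons_eq_iff)
  qed
  assume T: "T \<in> carrier_mat n n" and AT: "?A * T = (- 1 / to_fract (f 0)) \<cdot>\<^sub>m ?B"
  let ?z = "1 / to_fract (f 0)"
  have cA: "map_mat (\<lambda>a. [:a:]) ?A \<in> carrier_mat n n" using A by simp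
  have cT: "map_mat (\<lambda>a. [:- a:]) T \<in> carrier_mat n n" using T by simp
  have "map_mat (\<lambda>a. [:a:]) ?A * char_poly_matrix T
      = ?X \<cdot>\<^sub>m map_mat (\<lambda>a. [:a:]) ?A + map_mat (\<lambda>a. [:a:]) ?A * map_mat (\<lambda>a. [:- a:]) T"
    unfolding char_poly_matrix_def using A T
    by (subst mult_add_distrib_mat[OF cA _ cT])
      (simp_all add: mult_smult_distrib[OF cA, of "1\<^sub>m n" n] right_mult_one_mat[OF cA])
  also have "map_mat (\<lambda>a. [:a:]) ?A * map_mat (\<lambda>a. [:- a:]) T = [:?z:] \<cdot>\<^sub>m map_mat (\<lambda>a. [:a:]) ?B"
  proof -
    have "map_mat (\<lambda>a. [:- a:]) T = map_mat (\<lambda>a. [:a:]) ((- 1) \<cdot>\<^sub>m T)"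
      by (intro eq_matI) auto
    then have "map_mat (\<lambda>a. [:a:]) ?A * map_mat (\<lambda>a. [:- a:]) T
        = map_mat (\<lambda>a. [:a:]) (?A * ((- 1) \<cdot>\<^sub>m T))"
      using A T by (simp add: c.mat_hom_mult[of ?A n n _ n])
    also have "?A * ((- 1) \<cdot>\<^sub>m T) = (- 1) \<cdot>\<^sub>m (?A * T)"
      using A T by (intro mult_smult_distrib[of _ n n _ n]) auto
    also have "map_mat (\<lambda>a. [:a:]) ((- 1) \<cdot>\<^sub>m (?A * T)) = [:?z:] \<cdot>\<^sub>m map_mat (\<lambda>a. [:a:]) ?B"
      unfolding AT using B by (intro eq_matI) auto
    finally show ?thesis .
  qed
  finally have "det (?X \<cdot>\<^sub>m map_mat (\<lambda>a. [:a:]) ?A + [:?z:] \<cdot>\<^sub>m map_mat (\<lambda>a. [:a:]) ?B)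
      = [:det ?A:] * char_poly T"
    using det_mult[OF cA char_poly_matrix_closed[OF T]] by (simp add: char_poly_def c.hom_det)
  moreover have "(\<Sum>i\<le>n. [:to_fract (f i):] * ?X ^ (n - i) * [:to_fract (f 0) * ?z:] ^ i) = F1 n f"
    using f0 by (simp add: F1_def binary_form_def flip: one_pCons)
  ultimately have "(- 1) ^ (n div 2) * ([:det ?A:] * char_poly T) = [:to_fract r / to_fract (f 0):] * F1 n f"
    using special[of ?z] by (simp only:)
  moreover have "(- 1) ^ (n div 2) * ([:det ?A:] * char_poly T) = [:to_fract r:] * char_poly T"
    unfolding det[symmetric] by (cases "even (n div 2)") simp_all
  moreover have "[:to_fract r / to_fract (f 0):] = [:to_fract r:] * [:1 / to_fract (f 0):]" by simp
  ultimately have "[:to_fract r:] * char_poly T = [:to_fract r:] * ([:1 / to_fract (f 0):] * F1 n f)"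
    by (simp only: mult.assoc)
  moreover have "[:to_fract r:] \<noteq> 0" using r by simp
  ultimately have "char_poly T = [:1 / to_fract (f 0):] * F1 n f" using mult_left_cancel by blast
  then show "char_poly T = smult (1 / to_fract (f 0)) (F1 n f)" by simp
qed

lemma mat_inverse_correct:
  fixes M :: "'b::field mat"
  assumes M: "M \<in> carrier_mat n n" and "det M \<noteq> 0"
  shows "the (mat_inverse M) \<in> carrier_mat n n" "M * the (mat_inverse M) = 1\<^sub>m n"
    "the (mat_inverse M) * M = 1\<^sub>m n"
proof -
  have "M \<in> Units (ring_mat TYPE('b) n undefined)" by (rule det_non_zero_imp_unit[OF assms])
  with mat_inverse(1)[OF M, of undefined] obtain M' where "mat_inverse M = Some M'"
    by (cases "mat_inverse M") auto
  with mat_inverse(2)[OF M this]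
  show "the (mat_inverse M) \<in> carrier_mat n n" "M * the (mat_inverse M) = 1\<^sub>m n"
    "the (mat_inverse M) * M = 1\<^sub>m n" by auto
qed

context form_algebra
begin

lemma phi_gram_smult: "phi_gram (smult c s) b = c \<cdot>\<^sub>m phi_gram s b"
  by (intro eq_matI) (auto simp: phi_gram_def phi_smult)

lemma det_phi_gram:
  "det (phi_gram s b) = det (coord_mat b) * (det hankel * (det (mult_mat s) * det (coord_mat b)))"
  unfolding phi_gram_eq
  by (simp add: det_mult[of _ n] mult_carrier_mat[of _ n n] det_transpose[of _ n])

lemma phi_gram_mult:
  assumes W: "W \<in> carrier_mat n n" and "mult_mat t * coord_mat b = coord_mat b * W"
  shows "phi_gram (s * t) b = phi_gram s b * W"
  unfolding phi_gram_eq mult_mat_mult using assms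
  by (simp add: assoc_mult_mat[of _ n n _ n _ n] mult_carrier_mat[of _ n n])

text \<open>If W is the matrix of multiplication by \<theta> in the basis \<open>b\<close>, the
  second Gram matrix is -f_0 times the first one times W, and multiplying by \<open>Ai\<close>
  recovers W.\<close>

lemma mult_by_theta_matrix:
  assumes Ai: "Ai \<in> carrier_mat n n" "Ai * phi_gram \<gamma> b = 1\<^sub>m n"
    and P: "det (coord_mat b) \<noteq> 0"
  shows "mult_mat X * coord_mat b
    = coord_mat b * ((1 / F0) \<cdot>\<^sub>m (- (Ai * phi_gram (smult (- F0) (X * \<gamma>)) b)))"
proof -
  let ?P = "coord_mat b"
  obtain P' where P': "P' \<in> carrier_mat n n" "?P * P' = 1\<^sub>m n" "P' * ?P = 1\<^sub>m n"
    using invertible_matE[OF mat_carriers(2) P] by blast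
  define W where "W = P' * (mult_mat X * ?P)"
  have W: "W \<in> carrier_mat n n" using P'(1) by (simp add: W_def mult_carrier_mat[of _ n n])
  have PW: "mult_mat X * ?P = ?P * W"
    unfolding W_def assoc_mult_mat[OF mat_carriers(2) P'(1) mult_carrier_mat[OF mat_carriers(1,2)], symmetric] P'(2)
    by (simp add: left_mult_one_mat[of _ n n] mult_carrier_mat[of _ n n])
  have "phi_gram (smult (- F0) (X * \<gamma>)) b = (- F0) \<cdot>\<^sub>m (phi_gram \<gamma> b * W)"
    unfolding phi_gram_smult mult.commute[of X \<gamma>] phi_gram_mult[OF W PW] ..
  then have "Ai * phi_gram (smult (- F0) (X * \<gamma>)) b = (- F0) \<cdot>\<^sub>m ((Ai * phi_gram \<gamma> b) * W)"
    using Ai(1) W by (simp add: mult_smult_distrib[of _ n n _ n] mult_carrier_mat[of _ n n]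
        assoc_mult_mat[of _ n n _ n _ n])
  then have "(1 / F0) \<cdot>\<^sub>m (- (Ai * phi_gram (smult (- F0) (X * \<gamma>)) b)) = W"
    using W unfolding Ai(2) by (intro eq_matI) auto
  then show ?thesis using PW by simp
qed

text \<open>The changed basis c = gb has the Gram matrices \<open>A\<close> and \<open>B\<close>, so
  p_k(T) is the matrix of \<zeta>_k in it. As \<zeta>_k lies in R_F and \<open>c\<close> spans the
  same R_F-module as \<open>b\<close>, this matrix has entries in R.\<close>

lemma integral_p_mat_if_gram:
  assumes p: "(b, \<alpha>) \<in> H_pairs n f r" and g: "g \<in> Gn n"
    and A: "A = g * gram n f (pi_last n f) b \<alpha> * transpose_mat g"
    and B: "B = g * gram n f (pi_prev n f) b \<alpha> * transpose_mat g"
    and detA: "det (map_mat to_fract A) \<noteq> 0"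
    and Ai: "Ai \<in> carrier_mat n n" "Ai * map_mat to_fract A = 1\<^sub>m n"
    and k: "k \<in> {1..n - 1}"
  shows "p_mat n f k ((1 / F0) \<cdot>\<^sub>m (- (Ai * map_mat to_fract B))) \<in> integral_mats n"
proof -
  note H = H_pairsD[OF p] and gc = Gn_carrier[OF g]
  let ?\<gamma> = "KF_inverse n f \<alpha>"
  define c where "c = change_basis g b"
  have cc: "c \<in> carrier_vec n" using gc by (simp add: c_def change_basis_def)
  have ck: "c $ k = (\<Sum>j<n. smult (to_fract (g $$ (k, j))) (b $ j))" if "k < n" for k
    using that gc H(3) by (auto simp: c_def change_basis_def R_combination_def)
  have gram_c: "gram n f \<pi> b \<alpha> \<in> carrier_mat n n" for \<pi> by (simp add: gram_def)
  have Ac: "map_mat to_fract A = phi_gram ?\<gamma> c"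
    and Bc: "map_mat to_fract B = phi_gram (smult (- F0) (X * ?\<gamma>)) c"
    unfolding A B map_mat_to_fract_conj[OF gc gram_c] gram_eq_phi_gram[OF H(2,3,5)]
      c_def phi_gram_change_basis[OF gc H(3)] by (rule refl)+
  let ?P = "coord_mat c"
  \<comment> \<open>det(A) has det(P) as a factor.\<close>
  have P: "det ?P \<noteq> 0" using detA unfolding Ac det_phi_gram by auto
  define T where "T = (1 / F0) \<cdot>\<^sub>m (- (Ai * map_mat to_fract B))"
  have T: "T \<in> carrier_mat n n" using Ai(1) by (auto simp: T_def Bc mult_carrier_mat[of _ n n])
  have XP: "mult_mat X * ?P = ?P * T"
    unfolding T_def Bc using Ai P unfolding Ac by (intro mult_by_theta_matrix)
  have kn: "k < n" "1 \<le> k" using k by auto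
  obtain h where h: "h \<in> Gn n" "g * h = 1\<^sub>m n" "h * g = 1\<^sub>m n" by (rule Gn_inverse[OF g])
  note hc = Gn_carrier[OF h(1)]
  \<comment> \<open>The inverse of \<open>g\<close> over R expresses the old basis in the new
    one.\<close>
  have b_in_c: "b $ i \<in> R_span c" if i: "i < n" for i
  proof -
    have "(\<Sum>k<n. smult (to_fract (h $$ (i, k))) (c $ k))
        = (\<Sum>k<n. \<Sum>j<n. smult (to_fract (h $$ (i, k) * g $$ (k, j))) (b $ j))"
      by (simp add: ck smult_sum2)
    also have "\<dots> = (\<Sum>j<n. smult (to_fract (\<Sum>k<n. h $$ (i, k) * g $$ (k, j))) (b $ j))"
      by (subst sum.swap) (simp add: smult_sum)
    also have "\<dots> = (\<Sum>j<n. smult (to_fract ((h * g) $$ (i, j))) (b $ j))"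
      using i gc hc by (simp add: index_mult_mat_sum[of _ n n _ n] del: index_mult_mat)
    also have "\<dots> = (\<Sum>j<n. if j = i then b $ i else 0)"
      unfolding h(3) using i by (intro sum.cong) auto
    also have "\<dots> = b $ i" using i by simp
    finally show ?thesis unfolding R_span_iff carrier_vecD[OF cc] by (intro exI) (rule sym)
  qed
  have "R_span b \<subseteq> R_span c"
  proof
    fix u assume "u \<in> R_span b"
    then obtain e where "u = (\<Sum>k<n. smult (to_fract (e k)) (b $ k))"
      using H(3) unfolding R_span_iff by auto
    then show "u \<in> R_span c" using b_in_c by (auto intro!: R_span_sum R_span_smult)
  qed
  moreover have "zeta n f k * c $ j mod N \<in> R_span b" if "j < n" for j
  proof -
    have "c $ j \<in> R_span b"
      using that H(3) ck[OF that] by (auto intro!: R_span_sum R_span_smult R_span_basis)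
    moreover have "zeta n f k \<in> RF n f"
      using R_span_basis[of k "RF_basis n f"] kn by (simp add: RF_def RF_basis_def)
    ultimately show ?thesis using H(1) by (auto simp: based_ideal_def KF_mult_def)
  qed
  ultimately have "zeta n f k * c $ j mod N \<in> R_span c" if "j < n" for j
    using that by blast
  then have "\<forall>j\<in>{..<n}. \<exists>e. zeta n f k * c $ j mod N = (\<Sum>i<n. smult (to_fract (e i)) (c $ i))"
    unfolding R_span_iff carrier_vecD[OF cc] by blast
  from bchoice[OF this] obtain e where
    e: "\<And>j. j < n \<Longrightarrow> zeta n f k * c $ j mod N = (\<Sum>i<n. smult (to_fract (e j i)) (c $ i))"
    by blast
  define E where "E = mat n n (\<lambda>(i, j). e j i)"
  have E: "map_mat to_fract E \<in> carrier_mat n n" by (simp add: E_def)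
  let ?zc = "vec n (\<lambda>j. zeta n f k * c $ j)"
  have "mult_mat (zeta n f k) * ?P = coord_mat ?zc"
    by (rule coord_mat_mult[symmetric]) (use cc in auto)
  also have "\<dots> = ?P * map_mat to_fract E"
    unfolding coord_mat_combination_iff[OF E]
    by (auto simp: E_def e[symmetric])
  finally have eq: "?P * p_mat n f k T = ?P * map_mat to_fract E"
    using coord_mat_p_mat[OF T XP kn(1)] by simp
  obtain P' where P': "P' \<in> carrier_mat n n" "P' * ?P = 1\<^sub>m n"
    using invertible_matE[OF mat_carriers(2) P] by blast
  have pT: "p_mat n f k T \<in> carrier_mat n n" by (simp add: p_mat_def)
  have "p_mat n f k T = (P' * ?P) * p_mat n f k T" using pT P'(2) by simp
  also have "\<dots> = P' * (?P * map_mat to_fract E)"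
    using assoc_mult_mat[OF P'(1) mat_carriers(2) pT] eq by simp
  also have "\<dots> = (P' * ?P) * map_mat to_fract E"
    by (rule assoc_mult_mat[OF P'(1) mat_carriers(2) E, symmetric])
  also have "\<dots> = map_mat to_fract E" unfolding P'(2) using E by (rule left_mult_one_mat)
  finally show ?thesis unfolding T_def[symmetric] integral_mats_def
    by (rule image_eqI) (simp add: E_def)
qed

end

subsection \<open>From integrality to Gram matrices\<close>

lemma separable_form_squarefree:
  assumes "separable_form n f" "prime_elem p"
  shows "\<not> p * p dvd F1 n f"
proof
  assume "p * p dvd F1 n f"
  then obtain q where q: "F1 n f = p * (p * q)" by (auto simp: dvd_def mult.assoc)
  then have "p dvd F1 n f" by simp
  moreover have "pderiv (F1 n f) = p * (pderiv (p * q) + pderiv p * q)"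
    unfolding q by (simp add: pderiv_mult algebra_simps)
  then have "p dvd pderiv (F1 n f)" by simp
  ultimately have "p dvd 1" using assms(1) unfolding separable_form_def by (rule coprime_common_divisor[rotated])
  with prime_elem_not_unit[OF assms(2)] show False ..
qed

context form_algebra
begin

text \<open>Separability makes the characteristic polynomial squarefree, so the entries of a
  suitable left eigenvector span K_F, and \<theta> acts on them through \<open>T\<close>.\<close>

lemma theta_basis_exists:
  assumes T: "T \<in> carrier_mat n n" and \<chi>: "char_poly T = smult (1 / F0) N"
    and sep: "separable_form n f"
  obtains b where "b \<in> carrier_vec n" "\<And>k. k < n \<Longrightarrow> b $ k \<in> KF n"
    "det (coord_mat b) \<noteq> 0" "mult_mat X * coord_mat b = coord_mat b * T"
proof -
  have dvd: "char_poly T dvd u \<longleftrightarrow> N dvd u" for u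
    unfolding \<chi> by (simp add: smult_dvd_iff)
  have "\<not> p * p dvd char_poly T" if "prime_elem p" for p
    using separable_form_squarefree[OF sep that] unfolding \<chi> by (simp add: dvd_smult_iff)
  then obtain b0 where b0: "left_eigen n T b0"
    and span: "\<And>u. \<exists>c. char_poly T dvd u - (\<Sum>k<n. smult (c k) (b0 k))"
    using left_eigen_basis_exists[OF T n_pos] by blast
  define b where "b = vec n (\<lambda>k. b0 k mod N)"
  have b: "b \<in> carrier_vec n" by (simp add: b_def)
  have comb: "(\<Sum>k<n. smult (c k) (b0 k)) mod N = (\<Sum>k<n. smult (c k) (b $ k)) mod N" for c
    unfolding mod_N_sum by (intro sum.cong) (auto simp: b_def mod_smult_left)
  have eig: "X * b $ k mod N = (\<Sum>j<n. smult (T $$ (j, k)) (b $ j)) mod N" if "k < n" for k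
  proof -
    have "N dvd X * b0 k - (\<Sum>j<n. smult (T $$ (j, k)) (b0 j))"
      using b0 that unfolding left_eigen_def dvd by blast
    then have "X * b0 k mod N = (\<Sum>j<n. smult (T $$ (j, k)) (b0 j)) mod N"
      by (simp only: mod_eq_dvd_iff)
    moreover have "X * b $ k mod N = X * b0 k mod N"
      using that by (simp add: b_def mod_mult_right_eq del: mult_pCons_left)
    ultimately show ?thesis using comb by simp
  qed
  have "mult_mat X * coord_mat b = coord_mat (vec n (\<lambda>k. X * b $ k))"
    by (rule coord_mat_mult[symmetric]) (use b in auto)
  also have "\<dots> = coord_mat b * T"
    unfolding coord_mat_combination_iff[OF T] using eig by (simp del: mult_pCons_left)
  finally have XP: "mult_mat X * coord_mat b = coord_mat b * T" .
  have "\<forall>j. \<exists>c. X ^ j mod N = (\<Sum>k<n. smult (c k) (b $ k)) mod N"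
    using span[unfolded dvd, folded mod_eq_dvd_iff, unfolded comb] by blast
  from choice[OF this] obtain c where
    c: "\<And>j. X ^ j mod N = (\<Sum>k<n. smult (c j k) (b $ k)) mod N" by blast
  \<comment> \<open>The coefficients expressing the powers of \<theta> by \<open>b\<close> form a
    right inverse of the coordinate matrix, which is therefore invertible.\<close>
  define Q where "Q = mat n n (\<lambda>(k, j). c j k)"
  have Q: "Q \<in> carrier_mat n n" by (simp add: Q_def)
  have "coord_mat (vec n (\<lambda>j. X ^ j)) = coord_mat b * Q"
    unfolding coord_mat_combination_iff[OF Q] using c by (simp add: Q_def)
  moreover have "coord_mat (vec n (\<lambda>j. X ^ j)) = 1\<^sub>m n"
    by (intro eq_matI) (auto simp: coord_mat_def X_power_mod_N coeff_X_power)
  ultimately have "coord_mat b * Q = 1\<^sub>m n" by simp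
  then have "det (coord_mat b) * det Q = 1"
    using det_mult[OF mat_carriers(2) Q, of b] by simp
  then have "det (coord_mat b) \<noteq> 0" by auto
  moreover have "b $ k \<in> KF n" if "k < n" for k using that by (simp add: b_def KF_mod)
  ultimately show ?thesis using that b XP by blast
qed

text \<open>Symmetry of S and ST says that \<theta> is self-adjoint for S. It is also self-adjoint
  for the Hankel form, so the quotient of the two forms commutes with multiplication by \<theta> and
  is itself multiplication by some \<gamma>.\<close>

lemma symmetric_form_is_phi_gram:
  assumes P: "det (coord_mat b) \<noteq> 0"
    and T: "T \<in> carrier_mat n n" and XP: "mult_mat X * coord_mat b = coord_mat b * T"
    and S: "S \<in> carrier_mat n n" "transpose_mat S = S"
    and ST: "transpose_mat (S * T) = S * T"
  obtains \<gamma> where "degree \<gamma> < n" "S = phi_gram \<gamma> b"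
proof -
  let ?P = "coord_mat b" and ?C = "mult_mat X" and ?H = hankel
  obtain P' where P': "P' \<in> carrier_mat n n" "?P * P' = 1\<^sub>m n" "P' * ?P = 1\<^sub>m n"
    using invertible_matE[OF mat_carriers(2) P] by blast
  obtain H' where H': "H' \<in> carrier_mat n n" "?H * H' = 1\<^sub>m n" "H' * ?H = 1\<^sub>m n"
    using invertible_matE[OF mat_carriers(3) det_hankel_nz] by blast
  note [simp] = P'(1) H'(1) S(1) T mult_carrier_mat[of _ n n]
  note assoc = assoc_mult_mat[of _ n n _ n _ n]
  have cancel: "?P * (P' * M) = M" "P' * (?P * M) = M" "?H * (H' * M) = M" "H' * (?H * M) = M"
    if M: "M \<in> carrier_mat n n" for M
    using assoc_mult_mat[OF mat_carriers(2) P'(1) M, of b] assoc_mult_mat[OF P'(1) mat_carriers(2) M, of b]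
      assoc_mult_mat[OF mat_carriers(3) H'(1) M] assoc_mult_mat[OF H'(1) mat_carriers(3) M]
      P'(2,3) H'(2,3) M by simp_all
  have tcancel: "transpose_mat ?P * (transpose_mat P' * M) = M" if M: "M \<in> carrier_mat n n" for M
  proof -
    have "transpose_mat ?P * transpose_mat P' = 1\<^sub>m n"
      using transpose_mult[OF P'(1) mat_carriers(2), of b] P'(3) by simp
    then show ?thesis
      using M assoc[of "transpose_mat ?P" "transpose_mat P'" M] by simp
  qed
  \<comment> \<open>\<open>U\<close> is the form S written in the power basis, and \<open>Y\<close>
    compares it with the Hankel form.\<close>
  define U where "U = transpose_mat P' * (S * P')"
  define Y where "Y = H' * U"
  have U: "U \<in> carrier_mat n n" by (simp add: U_def)
  have Y: "Y \<in> carrier_mat n n" using U by (simp add: Y_def)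
  have C: "?C = ?P * (T * P')"
  proof -
    have "?C = ?C * (?P * P')" using P'(2) by (simp add: right_mult_one_mat[of _ n n])
    also have "\<dots> = (?C * ?P) * P'" by (simp add: assoc)
    finally show ?thesis by (simp add: XP assoc)
  qed
  have UC: "U * ?C = transpose_mat P' * ((S * T) * P')"
    unfolding U_def C by (simp add: assoc cancel)
  have "transpose_mat (U * ?C) = U * ?C"
    unfolding UC by (simp add: transpose_mult[of _ n n _ n] ST[unfolded transpose_mult[OF S(1) T] S(2)] S(2) assoc)
  moreover have "transpose_mat U = U"
    unfolding U_def by (simp add: transpose_mult[of _ n n _ n] S(2) assoc)
  ultimately have CU: "transpose_mat ?C * U = U * ?C"
    using transpose_mult[OF U mat_carriers(1), of X] by simp
  have "transpose_mat ?H = ?H"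
    using hankel_mult_mat_symmetric[of 1] unfolding mult_mat_1 right_mult_one_mat[OF mat_carriers(3)] .
  then have CH: "transpose_mat ?C * ?H = ?H * ?C"
    using hankel_mult_mat_symmetric[of X] transpose_mult[OF mat_carriers(3) mat_carriers(1), of X] by simp
  \<comment> \<open>Both forms satisfy C^T U = UC and C^T H = HC, so HYC = UC = C^T HY = HCY, and H
    cancels.\<close>
  have "?H * (Y * ?C) = U * ?C" unfolding Y_def using U by (simp add: assoc cancel)
  also have "\<dots> = transpose_mat ?C * (?H * Y)" unfolding CU[symmetric] Y_def using U by (simp add: cancel)
  also have "\<dots> = ?H * (?C * Y)"
  proof -
    have "transpose_mat ?C * (?H * Y) = (transpose_mat ?C * ?H) * Y" using Y by (simp add: assoc)
    then show ?thesis unfolding CH using Y by (simp add: assoc)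
  qed
  finally have "H' * (?H * (Y * ?C)) = H' * (?H * (?C * Y))" by simp
  then have "Y * ?C = ?C * Y" using Y by (simp add: cancel)
  then obtain \<gamma> where \<gamma>: "degree \<gamma> < n" "Y = mult_mat \<gamma>" by (rule commuting_is_mult_mat[OF Y])
  have "phi_gram \<gamma> b = transpose_mat ?P * (?H * (Y * ?P))" unfolding phi_gram_eq \<gamma>(2) ..
  also have "\<dots> = S"
    unfolding Y_def U_def by (simp add: assoc cancel tcancel P'(3) right_mult_one_mat[of _ n n])
  finally show ?thesis using that \<gamma>(1) by simp
qed

text \<open>The inverse of the multiplication matrix of \<gamma> again commutes with multiplication
  by \<theta>, so it is the multiplication matrix of an element \<alpha>, which is inverse to
  \<gamma>.\<close>

lemma KF_unit_of_det:
  assumes \<gamma>: "degree \<gamma> < n" and det: "det (mult_mat \<gamma>) \<noteq> 0"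
  obtains \<alpha> where "\<alpha> \<in> KF_units n f" "KF_inverse n f \<alpha> = \<gamma>" "\<alpha> * \<gamma> mod N = 1"
    "det (mult_mat \<alpha>) * det (mult_mat \<gamma>) = 1"
proof -
  obtain M where M: "M \<in> carrier_mat n n" "mult_mat \<gamma> * M = 1\<^sub>m n" "M * mult_mat \<gamma> = 1\<^sub>m n"
    using invertible_matE[OF mat_carriers(1) det] by blast
  note assoc = assoc_mult_mat[of _ n n _ n _ n]
  have "M * mult_mat X = M * (mult_mat X * (mult_mat \<gamma> * M))"
    using M by (simp add: right_mult_one_mat[of _ n n])
  also have "\<dots> = M * ((mult_mat X * mult_mat \<gamma>) * M)" using M(1) by (simp add: assoc)
  also have "mult_mat X * mult_mat \<gamma> = mult_mat \<gamma> * mult_mat X"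
    unfolding mult_mat_mult[symmetric] by (simp only: mult.commute)
  also have "M * ((mult_mat \<gamma> * mult_mat X) * M) = (M * mult_mat \<gamma>) * (mult_mat X * M)"
    using M(1) by (simp add: assoc mult_carrier_mat[of _ n n])
  also have "\<dots> = mult_mat X * M" unfolding M(3) using M(1)
    by (simp add: left_mult_one_mat[of _ n n] mult_carrier_mat[of _ n n])
  finally obtain \<alpha> where \<alpha>: "degree \<alpha> < n" "M = mult_mat \<alpha>"
    by (rule commuting_is_mult_mat[OF M(1)])
  \<comment> \<open>The first column of a multiplication matrix holds the coordinates of the element
    itself, so equal matrices give elements that are congruent modulo F(x,1).\<close>
  have m1: "mult_mat (\<alpha> * \<gamma>) = mult_mat 1"
    unfolding mult_mat_mult mult_mat_1 using M(3) \<alpha>(2) by simp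
  have "\<alpha> * \<gamma> mod N = 1 mod N"
  proof (rule poly_eqI)
    fix i
    show "coeff (\<alpha> * \<gamma> mod N) i = coeff (1 mod N) i"
    proof (cases "i < n")
      case True
      then show ?thesis
        using arg_cong[OF m1, of "\<lambda>M. M $$ (i, 0)"] n_pos by (simp add: mult_mat_def)
    qed (simp add: coeff_mod_N_ge)
  qed
  then have inv: "\<alpha> * \<gamma> mod N = 1" by (simp add: one_mod_N)
  have K: "\<gamma> \<in> KF n" "\<alpha> \<in> KF n" using \<gamma> \<alpha> by (simp_all add: KF_def)
  have "det (mult_mat \<alpha>) * det (mult_mat \<gamma>) = 1"
    using det_mult[OF M(1) mat_carriers(1), of \<gamma>] M(3) \<alpha>(2) by simp
  moreover have "\<alpha> \<in> KF_units n f" using K inv by (auto simp: KF_units_def KF_mult_def)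
  ultimately show ?thesis using that KF_inverse_eq[OF K(1) inv] inv by blast
qed

text \<open>Invertibility of the coordinate matrix gives linear independence. Integrality of p_k(T)
  says that \<zeta>_k maps each basis vector into the span, and bilinearity extends this to all of
  R_F.\<close>

lemma based_ideal_of_integral_p_mat:
  assumes b: "b \<in> carrier_vec n" "\<And>k. k < n \<Longrightarrow> b $ k \<in> KF n"
    and P: "det (coord_mat b) \<noteq> 0"
    and T: "T \<in> carrier_mat n n" and XP: "mult_mat X * coord_mat b = coord_mat b * T"
    and int: "\<forall>k\<in>{1..n - 1}. p_mat n f k T \<in> integral_mats n"
  shows "based_ideal n f b"
proof -
  let ?P = "coord_mat b"
  have indep: "c = 0\<^sub>v n" if c: "c \<in> carrier_vec n" "R_combination c b = 0" for c
  proof -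
    define v where "v = vec n (\<lambda>k. to_fract (c $ k))"
    have "?P *\<^sub>v v = 0\<^sub>v n"
    proof (rule eq_vecI)
      fix i assume "i < dim_vec (0\<^sub>v n :: 'a fract vec)"
      then have i: "i < n" by simp
      have "(?P *\<^sub>v v) $ i = (\<Sum>k<n. coeff (b $ k mod N) i * to_fract (c $ k))"
        using i by (simp add: v_def coord_mat_def scalar_prod_def lessThan_atLeast0)
      also have "\<dots> = coeff (R_combination c b) i"
        using b by (simp add: R_combination_def coeff_sum KF_mod_eq mult.commute)
      finally show "(?P *\<^sub>v v) $ i = 0\<^sub>v n $ i" using c(2) i by simp
    qed (simp add: coord_mat_def)
    moreover have "v \<in> carrier_vec n" by (simp add: v_def)
    ultimately have "v = 0\<^sub>v n"
      using P det_0_iff_vec_prod_zero_field[OF mat_carriers(2), of b] by blast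
    then have "v $ k = 0" if "k < n" for k using that by simp
    then have "c $ k = 0" if "k < n" for k using that by (simp add: v_def)
    then show ?thesis using c(1) by (intro eq_vecI) auto
  qed
  have RF_b: "RF_basis n f $ k * b $ j mod N \<in> R_span b" if k: "k < n" and j: "j < n" for k j
  proof (cases "k = 0")
    case True
    then show ?thesis using k j b R_span_basis[of j b] by (simp add: RF_basis_def KF_mod_eq)
  next
    case False
    then have "p_mat n f k T \<in> integral_mats n" using k int by auto
    then obtain E where E: "E \<in> carrier_mat n n" "p_mat n f k T = map_mat to_fract E"
      by (auto simp: integral_mats_def)
    have E': "map_mat to_fract E \<in> carrier_mat n n" using E by simp
    let ?zb = "vec n (\<lambda>j. zeta n f k * b $ j)"
    have "coord_mat ?zb = mult_mat (zeta n f k) * ?P"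
      by (rule coord_mat_mult) (use b in auto)
    also have "\<dots> = ?P * map_mat to_fract E"
      using coord_mat_p_mat[OF T XP k] E(2) by simp
    finally have "zeta n f k * b $ j mod N = (\<Sum>i<n. smult (to_fract (E $$ (i, j))) (b $ i)) mod N"
      unfolding coord_mat_combination_iff[OF E'] using j E(1) by auto
    also have "\<dots> = (\<Sum>i<n. smult (to_fract (E $$ (i, j))) (b $ i))"
      using b(2) by (simp add: mod_N_sum mod_smult_left KF_mod_eq)
    finally show ?thesis
      using False k b(1) by (auto simp: RF_basis_def intro!: R_span_sum R_span_smult R_span_basis)
  qed
  have "KF_mult n f \<rho> \<beta> \<in> R_span b" if \<rho>: "\<rho> \<in> RF n f" and \<beta>: "\<beta> \<in> R_span b" for \<rho> \<beta>
  proof -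
    obtain c where c: "\<rho> = (\<Sum>k<n. smult (to_fract (c k)) (RF_basis n f $ k))"
      using \<rho> unfolding RF_def R_span_iff by (auto simp: RF_basis_def)
    obtain d where d: "\<beta> = (\<Sum>j<n. smult (to_fract (d j)) (b $ j))"
      using \<beta> b(1) unfolding R_span_iff by auto
    have "KF_mult n f \<rho> \<beta> = (\<Sum>k<n. \<Sum>j<n. smult (to_fract (d j)) (smult (to_fract (c k))
        (RF_basis n f $ k * b $ j mod N)))"
      unfolding KF_mult_def c d
      by (simp only: sum_product mod_N_sum mult_smult_left mult_smult_right mod_smult_left)
    then show ?thesis by (simp only:) (intro R_span_sum R_span_smult RF_b; simp)
  qed
  then show ?thesis unfolding based_ideal_def using b indep by blast
qed

text \<open>The coordinates of \<open>\<gamma> b\<^sub>i b\<^sub>j\<close> in the basis of \<open>I\<^sub>F^(n-2)\<close> are, up to signs and the term with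
  \<open>f\<^bsub>n-1\<^esub>\<close>, the entries of \<open>A\<close> and of the matrices \<open>A p\<^sub>m(T)\<close>.\<close>

lemma ideal_square_subset:
  assumes b: "b \<in> carrier_vec n" and A: "A \<in> carrier_mat n n" "map_mat to_fract A = phi_gram \<gamma> b"
    and T: "T \<in> carrier_mat n n" and XP: "mult_mat X * coord_mat b = coord_mat b * T"
    and int: "\<forall>k\<in>{1..n - 1}. p_mat n f k T \<in> integral_mats n"
    and inv: "\<alpha> * \<gamma> mod N = 1"
  shows "ideal_mult n f (R_span b) (R_span b) \<subseteq> KF_mult n f \<alpha> ` IF n f"
proof -
  have bb: "\<gamma> * (b $ i * b $ j) mod N \<in> IF n f" if ij: "i < n" "j < n" for i j
  proof (rule IF_memI)
    show "degree (\<gamma> * (b $ i * b $ j) mod N) < n" by (rule mod_N_degree)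
    have "phi (\<gamma> * (b $ i * b $ j) mod N) = map_mat to_fract A $$ (i, j)"
      unfolding A(2) using ij by (simp add: phi_gram_def)
    then show "integral (phi (\<gamma> * (b $ i * b $ j) mod N))" using ij A(1) by simp
    fix m assume m: "1 \<le> m" "m < n"
    then have "p_mat n f m T \<in> integral_mats n" using int by auto
    then obtain E where E: "E \<in> carrier_mat n n" "p_mat n f m T = map_mat to_fract E"
      by (auto simp: integral_mats_def)
    have E': "map_mat to_fract E \<in> carrier_mat n n" using E by simp
    have "phi ((\<gamma> * (b $ i * b $ j) mod N) * zeta n f m) = phi (\<gamma> * zeta n f m * (b $ i * b $ j))"
      by (rule phi_cong) (simp only: mod_mult_left_eq, simp only: mult_ac)
    also have "\<dots> = phi_gram (\<gamma> * zeta n f m) b $$ (i, j)" using ij by (simp add: phi_gram_def)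
    also have "\<dots> = (map_mat to_fract A * map_mat to_fract E) $$ (i, j)"
      using phi_gram_mult[OF E', of "zeta n f m" b \<gamma>] coord_mat_p_mat[OF T XP m(2)]
      unfolding A(2) E(2) by simp
    also have "\<dots> = to_fract ((A * E) $$ (i, j))"
      using A(1) E(1) ij by (simp add: to_fract_hom.mat_hom_mult[OF A(1) E(1), symmetric] del: index_mult_mat(1))
    finally show "integral (phi ((\<gamma> * (b $ i * b $ j) mod N) * zeta n f m))" by simp
  qed
  have prod: "\<gamma> * (\<beta> * \<beta>') mod N \<in> IF n f" if \<beta>: "\<beta> \<in> R_span b" "\<beta>' \<in> R_span b" for \<beta> \<beta>'
  proof -
    obtain c d where c: "\<beta> = (\<Sum>j<n. smult (to_fract (c j)) (b $ j))"
      and d: "\<beta>' = (\<Sum>j<n. smult (to_fract (d j)) (b $ j))"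
      using \<beta> b unfolding R_span_iff by auto
    have "\<gamma> * (\<beta> * \<beta>') mod N = (\<Sum>i<n. \<Sum>j<n. smult (to_fract (d j)) (smult (to_fract (c i))
        (\<gamma> * (b $ i * b $ j) mod N)))"
      unfolding c d sum_product
      by (simp only: sum_distrib_left mod_N_sum mult_smult_left mult_smult_right mod_smult_left)
    then show ?thesis
      by (simp only: IF_def) (intro R_span_sum R_span_smult bb[unfolded IF_def]; simp)
  qed
  show ?thesis
  proof
    fix u assume "u \<in> ideal_mult n f (R_span b) (R_span b)"
    then obtain m :: nat and \<beta> \<beta>' where u: "u = (\<Sum>i<m. KF_mult n f (\<beta> i) (\<beta>' i))"
      and mem: "\<forall>i<m. \<beta> i \<in> R_span b \<and> \<beta>' i \<in> R_span b"
      unfolding ideal_mult_def by blast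
    have "\<gamma> * u mod N = (\<Sum>i<m. \<gamma> * (\<beta> i * \<beta>' i) mod N)"
      unfolding u KF_mult_def sum_distrib_left mod_N_sum mod_mult_right_eq ..
    then have "\<gamma> * u mod N \<in> IF n f"
      using mem prod unfolding IF_def by (auto intro!: R_span_sum)
    moreover have "u = KF_mult n f \<alpha> (\<gamma> * u mod N)"
    proof -
      have "KF_mult n f \<alpha> (\<gamma> * u mod N) = (\<alpha> * \<gamma>) * u mod N"
        unfolding KF_mult_def mod_mult_right_eq by (simp only: mult.assoc)
      also have "\<dots> = (\<alpha> * \<gamma> mod N) * u mod N" by (rule mod_mult_left_eq[symmetric])
      also have "\<dots> = u" unfolding inv by (simp add: u KF_mult_def mod_N_sum)
      finally show ?thesis ..
    qed
    ultimately show "u \<in> KF_mult n f \<alpha> ` IF n f" by blast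
  qed
qed

text \<open>The basis realises \<open>T\<close> as multiplication by \<theta>, and \<alpha> is the
  inverse of the \<gamma> that represents \<open>A\<close>. The second Gram matrix is then -f_0 A T
  = B.\<close>

lemma H_pair_exists:
  assumes A: "A \<in> carrier_mat n n" "transpose_mat A = A"
    and B: "B \<in> carrier_mat n n" "transpose_mat B = B"
    and detA: "(- 1) ^ (n div 2) * det (map_mat to_fract A) = to_fract r" and r: "r \<noteq> 0"
    and T: "T \<in> carrier_mat n n" and AT: "map_mat to_fract A * T = (- 1 / F0) \<cdot>\<^sub>m map_mat to_fract B"
    and \<chi>: "char_poly T = smult (1 / F0) N" and sep: "separable_form n f"
    and int: "\<forall>k\<in>{1..n - 1}. p_mat n f k T \<in> integral_mats n"
  obtains b \<alpha> where "(b, \<alpha>) \<in> H_pairs n f r"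
    "gram n f (pi_last n f) b \<alpha> = A" "gram n f (pi_prev n f) b \<alpha> = B"
proof -
  let ?A = "map_mat to_fract A" and ?B = "map_mat to_fract B"
  obtain b where b: "b \<in> carrier_vec n" "\<And>k. k < n \<Longrightarrow> b $ k \<in> KF n"
    and P: "det (coord_mat b) \<noteq> 0" and XP: "mult_mat X * coord_mat b = coord_mat b * T"
    using theta_basis_exists[OF T \<chi> sep] by blast
  have A': "?A \<in> carrier_mat n n" "transpose_mat ?A = ?A"
    using A by (simp_all add: map_mat_transpose)
  have "transpose_mat (c \<cdot>\<^sub>m ?B) = c \<cdot>\<^sub>m transpose_mat ?B" for c
    by (intro eq_matI) auto
  then have "transpose_mat (?A * T) = ?A * T"
    unfolding AT using B(2) by (simp add: map_mat_transpose)
  then obtain \<gamma> where \<gamma>: "degree \<gamma> < n" "?A = phi_gram \<gamma> b"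
    using symmetric_form_is_phi_gram[OF P T XP A'] by blast
  have dA: "det ?A \<noteq> 0" using detA r by auto
  then have "det (mult_mat \<gamma>) \<noteq> 0" unfolding \<gamma>(2) det_phi_gram by auto
  then obtain \<alpha> where \<alpha>: "\<alpha> \<in> KF_units n f" "KF_inverse n f \<alpha> = \<gamma>" "\<alpha> * \<gamma> mod N = 1"
    "det (mult_mat \<alpha>) * det (mult_mat \<gamma>) = 1"
    using KF_unit_of_det[OF \<gamma>(1)] by blast
  have sub: "ideal_mult n f (R_span b) (R_span b) \<subseteq> KF_mult n f \<alpha> ` IF n f"
    by (rule ideal_square_subset[OF b(1) A(1) \<gamma>(2) T XP int \<alpha>(3)])
  have based: "based_ideal n f b"
    by (rule based_ideal_of_integral_p_mat[OF b P T XP int])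
  have norm: "(ideal_norm n f b)\<^sup>2 = to_fract r * KF_norm n f \<alpha> * ideal_norm n f (IF_basis n f)"
  proof -
    let ?p = "det (coord_mat b)" and ?g = "det (mult_mat \<gamma>)" and ?a = "det (mult_mat \<alpha>)"
    have Nb: "ideal_norm n f b * F0 ^ (n - 1) = ?p" by (rule ideal_norm_eq[OF b])
    have "IF_basis n f $ k \<in> KF n" if "k < n" for k
      using that R_span_basis[of k "IF_basis n f"] IF_degree by (simp add: IF_def KF_def)
    then have NI: "ideal_norm n f (IF_basis n f) * F0 ^ (n - 1) = F0"
      using ideal_norm_eq[of "IF_basis n f"] det_coord_mat_IF_basis by (simp add: carrier_vecI)
    \<comment> \<open>This is the determinant of the congruence formula for \<open>A\<close>. The
      sign of the Hankel determinant cancels the given one, leaving r f_0^n = det(P)^2 N(\<gamma>),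
      where N(\<gamma>) is inverse to N(\<alpha>).\<close>
    have "to_fract r = (- 1) ^ (n div 2) * (?p * ((- 1) ^ (n div 2) / F0 ^ n * (?g * ?p)))"
      using detA unfolding \<gamma>(2) det_phi_gram det_hankel by simp
    also have "\<dots> = ?p * (?g * ?p) / F0 ^ n" by (cases "even (n div 2)") simp_all
    finally have "to_fract r * F0 ^ n = ?p\<^sup>2 * ?g" by (simp add: field_simps power2_eq_square)
    then have "to_fract r * F0 ^ n * ?a = ?p\<^sup>2 * (?a * ?g)" by (simp add: mult_ac)
    then have p2: "?p\<^sup>2 = to_fract r * F0 ^ n * ?a" unfolding \<alpha>(4) by simp
    \<comment> \<open>The powers of f_0 match because N(I) f_0^(n-1) = det(P) and N(I_F^(n-2))
      f_0^(n-1) = f_0.\<close>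
    have "(ideal_norm n f b)\<^sup>2 * (F0 ^ (n - 1))\<^sup>2 = to_fract r * ?a * (F0 * F0 ^ (n - 1))"
      unfolding power_mult_distrib[symmetric] Nb p2 using n_pos by (cases n) (simp_all add: mult_ac)
    also have "\<dots> = to_fract r * ?a * ideal_norm n f (IF_basis n f) * (F0 ^ (n - 1))\<^sup>2"
    proof -
      have "ideal_norm n f (IF_basis n f) * (F0 ^ (n - 1))\<^sup>2 = F0 * F0 ^ (n - 1)"
        unfolding power2_eq_square mult.assoc[symmetric] NI ..
      then show ?thesis by (simp only: mult.assoc)
    qed
    finally show ?thesis unfolding KF_norm_eq by simp
  qed
  have pair: "(b, \<alpha>) \<in> H_pairs n f r"
    using based \<alpha>(1) sub norm by (simp add: H_pairs_def)
  note gr = gram_eq_phi_gram[OF \<alpha>(1) b(1) sub, unfolded \<alpha>(2)]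
  have gA: "gram n f (pi_last n f) b \<alpha> = A"
    by (rule map_mat_to_fract_inj) (simp only: gr(1) \<gamma>(2))
  have "map_mat to_fract (gram n f (pi_prev n f) b \<alpha>) = (- F0) \<cdot>\<^sub>m (?A * T)"
    unfolding gr(2) phi_gram_smult mult.commute[of X \<gamma>] phi_gram_mult[OF T XP] \<gamma>(2) ..
  also have "\<dots> = ?B" unfolding AT using B by (intro eq_matI) auto
  finally have gB: "gram n f (pi_prev n f) b \<alpha> = B" by (rule map_mat_to_fract_inj)
  from that[OF pair gA gB] show ?thesis .
qed

end

section \<open>The integrality criterion for orbits\<close>

theorem theorem13:
  fixes n :: nat
    and f :: "nat \<Rightarrow> 'a::principal_ideal_domain"
    and r :: 'a
    and A B :: "'a mat"
  assumes "n \<ge> 1"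
    and "f 0 \<noteq> 0"
    and "separable_form n f"
    and "r dvd 1"
    and "A \<in> carrier_mat n n" and "transpose_mat A = A"
    and "B \<in> carrier_mat n n" and "transpose_mat B = B"
    and "(- 1) ^ (n div 2) *
           det (varX \<cdot>\<^sub>m map_mat (\<lambda>a. constXZ (to_fract a)) A +
                varZ \<cdot>\<^sub>m map_mat (\<lambda>b. constXZ (to_fract b)) B)
         = constXZ (to_fract r) * constXZ (1 / to_fract (f 0)) *
           binary_form n (\<lambda>i. constXZ (to_fract (f i))) varX (constXZ (to_fract (f 0)) * varZ)"
  shows "Gn_orbit n (A, B) \<in> orb n f ` H_set n f r \<longleftrightarrow>
    (\<forall>i\<in>{1..n - 1}.
       p_mat n f i ((1 / to_fract (f 0)) \<cdot>\<^sub>m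
         (- (the (mat_inverse (map_mat to_fract A)) * map_mat to_fract B)))
       \<in> integral_mats n)"
proof -
  interpret form_algebra n f using assms(1,2) by unfold_locales
  let ?A = "map_mat to_fract A" and ?B = "map_mat to_fract B"
  have r0: "r \<noteq> 0" using assms(4) by auto
  note pencil = char_poly_of_pencil[OF assms(2) r0 assms(5,7,9)]
  have A': "?A \<in> carrier_mat n n" and B': "?B \<in> carrier_mat n n" using assms(5,7) by simp_all
  have dA: "det ?A \<noteq> 0"
  proof
    assume "det ?A = 0"
    with pencil(1) r0 show False by simp
  qed
  define Ai where "Ai = the (mat_inverse ?A)"
  have Ai: "Ai \<in> carrier_mat n n" "?A * Ai = 1\<^sub>m n" "Ai * ?A = 1\<^sub>m n"
    unfolding Ai_def by (rule mat_inverse_correct[OF A' dA])+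
  define T where "T = (1 / to_fract (f 0)) \<cdot>\<^sub>m (- (Ai * ?B))"
  have AiB: "Ai * ?B \<in> carrier_mat n n" using Ai(1) B' by (rule mult_carrier_mat)
  then have T: "T \<in> carrier_mat n n" by (auto simp: T_def)
  \<comment> \<open>The matrix \<open>T\<close> is characterised by A T = -B/f_0, the form in which
    both directions use it.\<close>
  have "T = (- 1 / to_fract (f 0)) \<cdot>\<^sub>m (Ai * ?B)"
    unfolding T_def using AiB by (intro eq_matI) auto
  then have "?A * T = (- 1 / to_fract (f 0)) \<cdot>\<^sub>m (?A * (Ai * ?B))"
    using mult_smult_distrib[OF A' AiB] by simp
  also have "?A * (Ai * ?B) = ?B"
    using assoc_mult_mat[OF A' Ai(1) B'] Ai(2) left_mult_one_mat[OF B'] by simp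
  finally have AT: "?A * T = (- 1 / to_fract (f 0)) \<cdot>\<^sub>m ?B" .
  have "Gn_orbit n (A, B) \<in> orb n f ` H_set n f r \<longleftrightarrow>
      (\<forall>i\<in>{1..n - 1}. p_mat n f i T \<in> integral_mats n)"
  proof
    assume "Gn_orbit n (A, B) \<in> orb n f ` H_set n f r"
    then obtain C where C: "C \<in> H_set n f r" "Gn_orbit n (A, B) = orb n f C" by blast
    \<comment> \<open>An orbit contains its own representative, so \<open>(A, B)\<close> lies in the
      orbit of the Gram matrices of some pair in the class.\<close>
    have "(A, B) \<in> orb n f C" using Gn_orbit_self[OF assms(5,7)] C(2) by simp
    then obtain b \<alpha> where b: "(b, \<alpha>) \<in> C"
      "(A, B) \<in> Gn_orbit n (gram n f (pi_last n f) b \<alpha>, gram n f (pi_prev n f) b \<alpha>)"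
      unfolding orb_def by blast
    then obtain g where g: "g \<in> Gn n" "A = g * gram n f (pi_last n f) b \<alpha> * transpose_mat g"
      "B = g * gram n f (pi_prev n f) b \<alpha> * transpose_mat g"
      by (auto simp: Gn_orbit_def)
    have "(b, \<alpha>) \<in> H_pairs n f r"
      using C(1) b(1) by (auto simp: H_set_def quotient_def H_rel_def)
    then show "\<forall>i\<in>{1..n - 1}. p_mat n f i T \<in> integral_mats n"
      unfolding T_def using integral_p_mat_if_gram[OF _ g dA Ai(1,3)] by blast
  next
    assume int: "\<forall>i\<in>{1..n - 1}. p_mat n f i T \<in> integral_mats n"
    obtain b \<alpha> where p: "(b, \<alpha>) \<in> H_pairs n f r"
      and gram: "gram n f (pi_last n f) b \<alpha> = A" "gram n f (pi_prev n f) b \<alpha> = B"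
      by (rule H_pair_exists[OF assms(5-8) pencil(1) r0 T AT pencil(2)[OF T AT] assms(3) int])
    have "H_rel n f r `` {(b, \<alpha>)} \<in> H_set n f r"
      unfolding H_set_def using p by (rule quotientI)
    moreover have "orb n f (H_rel n f r `` {(b, \<alpha>)}) = Gn_orbit n (A, B)"
      using orb_class[OF p] unfolding gram .
    ultimately show "Gn_orbit n (A, B) \<in> orb n f ` H_set n f r" by (metis imageI)
  qed
  then show ?thesis unfolding T_def Ai_def .
qed

end
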